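(* $\mathsf{ACA}_0$ proves that every $\Sigma^0_1$-PID admits a Dedekind--Hasse norm.
   Context: $\mathsf{ACA}_0$: basic arithmetic with comprehension for all arithmetical formulas. A $\Sigma^0_1$-PID is a countable integral domain (commutative ring with unity, no nonzero zero-divisors) in which every $\Sigma^0_1$-ideal — a sequence $\langle a_0,a_1,\ldots\rangle$ of ring elements such that for all $i,j,r,s$ some $a_k=a_ir+a_js$ — equals (by mutual inclusion of membership) a principal ideal $(c)=\{cr:r\in R\}$. A Dedekind--Hasse norm on $R$ is a function $f:R\to\mathbb{N}$ such that (i) $f(r)=0$ iff $r=0$; (ii) for all nonzero $a,b$, either $b\mid a$ or there are $x,y$ with $0<f(ax+by)<f(b)$; (iii) for all nonzero $a,b$, $f(a)\le f(ab)$. *)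

theory Defs
  imports Main
begin

text \<open>
  The language of second-order arithmetic, with a sort of numbers and a sort of sets. Bound
  variables are de Bruijn indices, counted separately for each sort; the only set terms are set
  variables, and equality of sets is not primitive.
\<close>

datatype tm = Var nat | Zero | One | Plus tm tm | Times tm tm

datatype fm =
    Bot
  | Eq tm tm    (infix \<open>\<^bold>=\<close> 60)
  | Less tm tm  (infix \<open>\<^bold><\<close> 60)
  | Mem tm nat  (infix \<open>\<^bold>\<in>\<close> 60)
  | Imp fm fm   (infixr \<open>\<^bold>\<longrightarrow>\<close> 35)
  | AllN fm
  | AllS fm

abbreviation Neg :: "fm \<Rightarrow> fm" (\<open>\<^bold>\<not> _\<close> [50] 50)
  where "\<^bold>\<not> p \<equiv> p \<^bold>\<longrightarrow> Bot"

abbreviation Top :: fm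
  where "Top \<equiv> \<^bold>\<not> Bot"

abbreviation Or :: "fm \<Rightarrow> fm \<Rightarrow> fm" (infixr \<open>\<^bold>\<or>\<close> 40)
  where "p \<^bold>\<or> q \<equiv> (\<^bold>\<not> p) \<^bold>\<longrightarrow> q"

abbreviation And :: "fm \<Rightarrow> fm \<Rightarrow> fm" (infixr \<open>\<^bold>\<and>\<close> 45)
  where "p \<^bold>\<and> q \<equiv> \<^bold>\<not> (p \<^bold>\<longrightarrow> \<^bold>\<not> q)"

abbreviation Iff :: "fm \<Rightarrow> fm \<Rightarrow> fm" (infix \<open>\<^bold>\<longleftrightarrow>\<close> 34)
  where "p \<^bold>\<longleftrightarrow> q \<equiv> (p \<^bold>\<longrightarrow> q) \<^bold>\<and> (q \<^bold>\<longrightarrow> p)"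

abbreviation ExN :: "fm \<Rightarrow> fm"
  where "ExN p \<equiv> \<^bold>\<not> AllN (\<^bold>\<not> p)"

abbreviation ExS :: "fm \<Rightarrow> fm"
  where "ExS p \<equiv> \<^bold>\<not> AllS (\<^bold>\<not> p)"

primrec subst_tm :: "(nat \<Rightarrow> tm) \<Rightarrow> tm \<Rightarrow> tm" where
  "subst_tm s (Var n) = s n"
| "subst_tm s Zero = Zero"
| "subst_tm s One = One"
| "subst_tm s (Plus t u) = Plus (subst_tm s t) (subst_tm s u)"
| "subst_tm s (Times t u) = Times (subst_tm s t) (subst_tm s u)"

abbreviation lift_tm :: "tm \<Rightarrow> tm"
  where "lift_tm \<equiv> subst_tm (\<lambda>n. Var (Suc n))"

text \<open>Simultaneous capture-avoiding substitution of terms for the free number variables (first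
  argument) and of set variables for the free set variables (second argument).\<close>

primrec subst :: "(nat \<Rightarrow> tm) \<Rightarrow> (nat \<Rightarrow> nat) \<Rightarrow> fm \<Rightarrow> fm" where
  "subst s r Bot = Bot"
| "subst s r (t \<^bold>= u) = (subst_tm s t \<^bold>= subst_tm s u)"
| "subst s r (t \<^bold>< u) = (subst_tm s t \<^bold>< subst_tm s u)"
| "subst s r (t \<^bold>\<in> X) = (subst_tm s t \<^bold>\<in> r X)"
| "subst s r (p \<^bold>\<longrightarrow> q) = (subst s r p \<^bold>\<longrightarrow> subst s r q)"
| "subst s r (AllN p) = AllN (subst (case_nat (Var 0) (\<lambda>n. lift_tm (s n))) r p)"
| "subst s r (AllS p) = AllS (subst s (case_nat 0 (\<lambda>n. Suc (r n))) p)"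

abbreviation liftN :: "fm \<Rightarrow> fm"
  where "liftN \<equiv> subst (\<lambda>n. Var (Suc n)) (\<lambda>X. X)"

abbreviation liftS :: "fm \<Rightarrow> fm"
  where "liftS \<equiv> subst Var Suc"

abbreviation instN :: "tm \<Rightarrow> fm \<Rightarrow> fm"
  where "instN t \<equiv> subst (case_nat t Var) (\<lambda>X. X)"

abbreviation instS :: "nat \<Rightarrow> fm \<Rightarrow> fm"
  where "instS X \<equiv> subst Var (case_nat X (\<lambda>Y. Y))"

text \<open>
  Classical natural deduction with equality of numbers, from a set \<open>T\<close> of axioms and a list of
  assumptions. An axiom with free variables stands for its universal closure: the
  eigenvariable condition of the rules \<open>AllN_I\<close> and \<open>AllS_I\<close> concerns the assumptions only.
\<close>

inductive derives :: "fm set \<Rightarrow> fm list \<Rightarrow> fm \<Rightarrow> bool" for T :: "fm set" where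
  Axiom: "p \<in> T \<Longrightarrow> derives T G p"
| Assm: "p \<in> set G \<Longrightarrow> derives T G p"
| Imp_I: "derives T (p # G) q \<Longrightarrow> derives T G (p \<^bold>\<longrightarrow> q)"
| Imp_E: "derives T G (p \<^bold>\<longrightarrow> q) \<Longrightarrow> derives T G p \<Longrightarrow> derives T G q"
| Classical: "derives T ((\<^bold>\<not> p) # G) Bot \<Longrightarrow> derives T G p"
| AllN_I: "derives T (map liftN G) p \<Longrightarrow> derives T G (AllN p)"
| AllN_E: "derives T G (AllN p) \<Longrightarrow> derives T G (instN t p)"
| AllS_I: "derives T (map liftS G) p \<Longrightarrow> derives T G (AllS p)"
| AllS_E: "derives T G (AllS p) \<Longrightarrow> derives T G (instS X p)"
| Eq_refl: "derives T G (t \<^bold>= t)"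
| Eq_subst: "derives T G (t \<^bold>= u) \<Longrightarrow> derives T G (instN t p) \<Longrightarrow> derives T G (instN u p)"

definition proves :: "fm set \<Rightarrow> fm \<Rightarrow> bool" (infix \<open>\<turnstile>\<close> 30)
  where "T \<turnstile> p \<longleftrightarrow> derives T [] p"

text \<open>Set variables may occur in an arithmetical formula as parameters.\<close>

primrec arithmetical :: "fm \<Rightarrow> bool" where
  "arithmetical Bot \<longleftrightarrow> True"
| "arithmetical (t \<^bold>= u) \<longleftrightarrow> True"
| "arithmetical (t \<^bold>< u) \<longleftrightarrow> True"
| "arithmetical (t \<^bold>\<in> X) \<longleftrightarrow> True"
| "arithmetical (p \<^bold>\<longrightarrow> q) \<longleftrightarrow> arithmetical p \<and> arithmetical q"
| "arithmetical (AllN p) \<longleftrightarrow> arithmetical p"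
| "arithmetical (AllS p) \<longleftrightarrow> False"

definition basic_axioms :: "fm set" where
  "basic_axioms =
    (let m = Var 0; n = Var 1 in
     {\<^bold>\<not> (Plus n One \<^bold>= Zero),
      (Plus m One \<^bold>= Plus n One) \<^bold>\<longrightarrow> (m \<^bold>= n),
      Plus m Zero \<^bold>= m,
      Plus m (Plus n One) \<^bold>= Plus (Plus m n) One,
      Times m Zero \<^bold>= Zero,
      Times m (Plus n One) \<^bold>= Plus (Times m n) m,
      \<^bold>\<not> (m \<^bold>< Zero),
      (m \<^bold>< Plus n One) \<^bold>\<longleftrightarrow> ((m \<^bold>< n) \<^bold>\<or> (m \<^bold>= n))})"

definition induction_axiom :: fm where
  "induction_axiom =
    AllS ((Zero \<^bold>\<in> 0) \<^bold>\<and> AllN ((Var 0 \<^bold>\<in> 0) \<^bold>\<longrightarrow> (Plus (Var 0) One \<^bold>\<in> 0)) \<^bold>\<longrightarrow> AllN (Var 0 \<^bold>\<in> 0))"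

text \<open>The set of all \<open>n\<close> satisfying \<open>p\<close>, where \<open>n\<close> is the number variable \<open>0\<close> of \<open>p\<close> and all
  other free variables are parameters; by \<open>liftS\<close> the new set does not occur in \<open>p\<close>.\<close>

definition comprehension :: "fm \<Rightarrow> fm" where
  "comprehension p = ExS (AllN ((Var 0 \<^bold>\<in> 0) \<^bold>\<longleftrightarrow> liftS p))"

definition ACA0 :: "fm set" where
  "ACA0 = basic_axioms \<union> {induction_axiom} \<union> {comprehension p | p. arithmetical p}"

text \<open>
  To write formulas with named variables, the free variables are used as names: \<open>all_n xs p\<close>
  binds the free number variables \<open>xs\<close> of \<open>p\<close>, and similarly for existential quantifiers and for
  sets. A bound name is chosen different from every other name in its scope.
\<close>

definition bindN :: "nat \<Rightarrow> fm \<Rightarrow> fm"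
  where "bindN x = subst (\<lambda>y. if y = x then Var 0 else Var (Suc y)) (\<lambda>X. X)"

definition bindS :: "nat \<Rightarrow> fm \<Rightarrow> fm"
  where "bindS X = subst Var (\<lambda>Y. if Y = X then 0 else Suc Y)"

definition all_n :: "nat list \<Rightarrow> fm \<Rightarrow> fm"
  where "all_n xs p = foldr (\<lambda>x q. AllN (bindN x q)) xs p"

definition ex_n :: "nat list \<Rightarrow> fm \<Rightarrow> fm"
  where "ex_n xs p = foldr (\<lambda>x q. ExN (bindN x q)) xs p"

definition all_s :: "nat list \<Rightarrow> fm \<Rightarrow> fm"
  where "all_s Xs p = foldr (\<lambda>X q. AllS (bindS X q)) Xs p"

definition ex_s :: "nat list \<Rightarrow> fm \<Rightarrow> fm"
  where "ex_s Xs p = foldr (\<lambda>X q. ExS (bindS X q)) Xs p"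

text \<open>The pairing map \<open>(i, j) = (i + j)\<^sup>2 + i\<close>, an injection provably in \<open>ACA0\<close>.\<close>

definition pair_tm :: "tm \<Rightarrow> tm \<Rightarrow> tm"
  where "pair_tm t u = Plus (Times (Plus t u) (Plus t u)) t"

definition conjs :: "fm list \<Rightarrow> fm"
  where "conjs ps = foldr (\<^bold>\<and>) ps Top"

text \<open>
  A countable ring is given by a set of numbers, two sets of coded triples \<open>((a, b), c)\<close> that are
  the graphs of the operations, and two numbers. The variables named here stand for these data
  throughout, the last two for a sequence of ring elements and for a norm. The names
  \<open>0\<close> and \<open>1\<close> being taken, other number variables are named from \<open>2\<close> on.
\<close>

abbreviation (input) carrier_var :: nat where "carrier_var \<equiv> 0"
abbreviation (input) plus_var :: nat where "plus_var \<equiv> 1"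
abbreviation (input) times_var :: nat where "times_var \<equiv> 2"
abbreviation (input) seq_var :: nat where "seq_var \<equiv> 3"
abbreviation (input) norm_var :: nat where "norm_var \<equiv> 4"
abbreviation (input) zero_var :: nat where "zero_var \<equiv> 0"
abbreviation (input) one_var :: nat where "one_var \<equiv> 1"

definition eq_var :: "nat \<Rightarrow> nat \<Rightarrow> fm"
  where "eq_var x y = (Var x \<^bold>= Var y)"

definition in_ring :: "nat \<Rightarrow> fm"
  where "in_ring a = (Var a \<^bold>\<in> carrier_var)"

definition nonzero :: "nat \<Rightarrow> fm"
  where "nonzero a = (in_ring a \<^bold>\<and> \<^bold>\<not> eq_var a zero_var)"

definition maps2_to :: "nat \<Rightarrow> nat \<Rightarrow> nat \<Rightarrow> nat \<Rightarrow> fm"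
  where "maps2_to X a b c = (pair_tm (pair_tm (Var a) (Var b)) (Var c) \<^bold>\<in> X)"

definition sum_is :: "nat \<Rightarrow> nat \<Rightarrow> nat \<Rightarrow> fm"
  where "sum_is = maps2_to plus_var"

definition prod_is :: "nat \<Rightarrow> nat \<Rightarrow> nat \<Rightarrow> fm"
  where "prod_is = maps2_to times_var"

definition maps_to :: "nat \<Rightarrow> nat \<Rightarrow> nat \<Rightarrow> fm"
  where "maps_to X x y = (pair_tm (Var x) (Var y) \<^bold>\<in> X)"

text \<open>\<open>is_fun D C X\<close>: the set \<open>X\<close> is the graph of a function from the class \<open>D\<close> to the class \<open>C\<close>.\<close>

definition is_fun :: "(nat \<Rightarrow> fm) \<Rightarrow> (nat \<Rightarrow> fm) \<Rightarrow> nat \<Rightarrow> fm" where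
  "is_fun D C X = (let x = 2; y = 3; y' = 4; w = 5 in
    conjs [
      all_n [w] ((Var w \<^bold>\<in> X) \<^bold>\<longrightarrow>
        ex_n [x, y] (conjs [D x, C y, Var w \<^bold>= pair_tm (Var x) (Var y)])),
      all_n [x] (D x \<^bold>\<longrightarrow> ex_n [y] (conjs [C y, maps_to X x y])),
      all_n [x, y, y'] (conjs [maps_to X x y, maps_to X x y'] \<^bold>\<longrightarrow> eq_var y y')])"

definition is_binop :: "nat \<Rightarrow> fm" where
  "is_binop X = (let a = 2; b = 3; c = 4; c' = 5; w = 6 in
    conjs [
      all_n [w] ((Var w \<^bold>\<in> X) \<^bold>\<longrightarrow>
        ex_n [a, b, c] (conjs [in_ring a, in_ring b, in_ring c,
          Var w \<^bold>= pair_tm (pair_tm (Var a) (Var b)) (Var c)])),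
      all_n [a, b] (conjs [in_ring a, in_ring b] \<^bold>\<longrightarrow>
        ex_n [c] (conjs [in_ring c, maps2_to X a b c])),
      all_n [a, b, c, c'] (conjs [maps2_to X a b c, maps2_to X a b c'] \<^bold>\<longrightarrow> eq_var c c')])"

definition is_comm_ring :: fm where
  "is_comm_ring = (let a = 2; b = 3; c = 4; u = 5; v = 6; w = 7; d = 8 in
    conjs [
      in_ring zero_var, in_ring one_var, is_binop plus_var, is_binop times_var,
      all_n [a, b, c, u, v, w] (conjs [sum_is a b u, sum_is u c w, sum_is b c v] \<^bold>\<longrightarrow> sum_is a v w),
      all_n [a, b, c] (sum_is a b c \<^bold>\<longrightarrow> sum_is b a c),
      all_n [a] (in_ring a \<^bold>\<longrightarrow> sum_is a zero_var a),
      all_n [a] (in_ring a \<^bold>\<longrightarrow> ex_n [b] (conjs [in_ring b, sum_is a b zero_var])),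
      all_n [a, b, c, u, v, w] (conjs [prod_is a b u, prod_is u c w, prod_is b c v] \<^bold>\<longrightarrow> prod_is a v w),
      all_n [a, b, c] (prod_is a b c \<^bold>\<longrightarrow> prod_is b a c),
      all_n [a] (in_ring a \<^bold>\<longrightarrow> prod_is a one_var a),
      all_n [a, b, c, u, v, w, d]
        (conjs [sum_is b c u, prod_is a u d, prod_is a b v, prod_is a c w] \<^bold>\<longrightarrow> sum_is v w d)])"

text \<open>It is not required that \<open>1\<close> differ from \<open>0\<close>; this only admits the trivial ring in addition.\<close>

definition is_integral_domain :: fm where
  "is_integral_domain = (let a = 2; b = 3 in
    conjs [
      is_comm_ring,
      all_n [a, b] (prod_is a b zero_var \<^bold>\<longrightarrow> (eq_var a zero_var \<^bold>\<or> eq_var b zero_var))])"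

definition is_sigma1_ideal :: fm where
  "is_sigma1_ideal =
    (let i = 2; j = 3; r = 4; s = 5; ai = 6; aj = 7; u = 8; v = 9; w = 10; k = 11 in
    conjs [
      is_fun (\<lambda>_. Top) in_ring seq_var,
      all_n [i, j, r, s, ai, aj, u, v, w]
        (conjs [in_ring r, in_ring s, maps_to seq_var i ai, maps_to seq_var j aj,
           prod_is ai r u, prod_is aj s v, sum_is u v w] \<^bold>\<longrightarrow>
         ex_n [k] (maps_to seq_var k w))])"

definition is_sigma1_PID :: fm where
  "is_sigma1_PID = (let c = 2; x = 3; k = 4; r = 5 in
    conjs [
      is_integral_domain,
      all_s [seq_var] (is_sigma1_ideal \<^bold>\<longrightarrow>
        ex_n [c] (conjs [in_ring c,
          all_n [x] (ex_n [k] (maps_to seq_var k x) \<^bold>\<longleftrightarrow>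
            ex_n [r] (conjs [in_ring r, prod_is c r x]))]))])"

definition is_Dedekind_Hasse_norm :: fm where
  "is_Dedekind_Hasse_norm =
    (let a = 2; b = 3; q = 4; x = 5; y = 6; u = 7; v = 8; w = 9; m = 10; n = 11; c = 12 in
    conjs [
      is_fun in_ring (\<lambda>_. Top) norm_var,
      all_n [a] (in_ring a \<^bold>\<longrightarrow> ((pair_tm (Var a) Zero \<^bold>\<in> norm_var) \<^bold>\<longleftrightarrow> eq_var a zero_var)),
      all_n [a, b] (conjs [nonzero a, nonzero b] \<^bold>\<longrightarrow>
        (ex_n [q] (conjs [in_ring q, prod_is b q a]) \<^bold>\<or>
         ex_n [x, y, u, v, w, m, n]
           (conjs [in_ring x, in_ring y, prod_is a x u, prod_is b y v, sum_is u v w,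
              maps_to norm_var w m, maps_to norm_var b n, Zero \<^bold>< Var m, Var m \<^bold>< Var n]))),
      all_n [a, b, c, m, n]
        (conjs [nonzero a, nonzero b, prod_is a b c, maps_to norm_var a m, maps_to norm_var c n] \<^bold>\<longrightarrow>
         ((Var m \<^bold>< Var n) \<^bold>\<or> eq_var m n))])"

definition sigma1_PIDs_have_Dedekind_Hasse_norm :: fm where
  "sigma1_PIDs_have_Dedekind_Hasse_norm =
    all_s [carrier_var, plus_var, times_var] (all_n [zero_var, one_var]
      (is_sigma1_PID \<^bold>\<longrightarrow> ex_s [norm_var] is_Dedekind_Hasse_norm))"

end

theory Submission
  imports Defs "HOL-Library.Countable_Set" "HOL-Algebra.Ring"
begin

text \<open>
  By a Henkin completeness theorem it suffices to argue in an arbitrary, possibly nonstandard, model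
  of \<open>ACA0\<close>, with induction and comprehension for arithmetically definable predicates only.

  In such a model every definable ideal is principal. For \<open>b \<noteq> 0\<close> there are, up to associates, only
  boundedly many divisors of \<open>b\<close>: otherwise take a counterexample minimal for divisibility and split
  off an irreducible factor. Choose \<open>m\<close> divisible by all positive numbers up to the codes of these
  divisors, each divisor represented by the least code \<open>i\<close> in its class; then the numbers
  \<open>1 + (i + 1) m\<close> are pairwise coprime. The norm of \<open>b\<close> is the least positive common multiple of
  these numbers, minimised over \<open>m\<close>. Passing from \<open>b\<close> to a proper divisor deletes the coprime factor
  that belongs to \<open>b\<close> itself, so the norm drops strictly, and this gives the Dedekind--Hasse property
  because any two elements generate a principal ideal.
\<close>

section \<open>Substitution and derivability\<close>

text \<open>The obstacle is that a model may be nonstandard: recursion along chains of divisors,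
  finite lists and finite products are available only after coding, and the classical norm 2^k, with
  k the number of prime factors, would first need a coded factorisation. Both are replaced by
  statements about single elements. Ascending chains of ideals give way to a greedy ideal whose
  every stage is described by one ring element. A bounded set of divisor codes is stored in one
  number v, as in Goedel's beta function, by the conditions that 1 + (i + 1) m divides v; as these
  moduli are coprime, the least such v behaves like their product and grows strictly with the set.
  Writing i + 1 makes each modulus exceed 1 even for the code 0. Recording classes of divisors
  instead of counting prime factors gives strictness without unique factorisation: a proper divisor
  of b lacks the class of b itself.\<close>

lemma subst_tm_subst_tm: "subst_tm s (subst_tm s' t) = subst_tm (\<lambda>n. subst_tm s (s' n)) t"
  by (induction t) auto

lemma subst_tm_Var [simp]: "subst_tm Var t = t"
  by (induction t) auto

lemma case_nat_Var [simp]: "case_nat (Var 0) (\<lambda>n. Var (Suc n)) = Var"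
  by (auto split: nat.split)

lemma case_nat_index [simp]: "case_nat 0 Suc = (\<lambda>n. n)"
  by (auto split: nat.split)

lemma subst_id [simp]: "subst Var (\<lambda>X. X) p = p"
  by (induction p) auto

lemma subst_subst:
  "subst s r (subst s' r' p) = subst (\<lambda>n. subst_tm s (s' n)) (\<lambda>X. r (r' X)) p"
proof (induction p arbitrary: s r s' r')
  case (AllN p)
  have "(\<lambda>n. subst_tm (case_nat (Var 0) (\<lambda>n. lift_tm (s n)))
          (case n of 0 \<Rightarrow> Var 0 | Suc n \<Rightarrow> lift_tm (s' n))) =
        case_nat (Var 0) (\<lambda>n. lift_tm (subst_tm s (s' n)))"
    by (auto simp: subst_tm_subst_tm split: nat.split)
  then show ?case by (simp add: AllN)
next
  case (AllS p)
  have "(\<lambda>X. case (case X of 0 \<Rightarrow> 0 | Suc X \<Rightarrow> Suc (r' X)) of 0 \<Rightarrow> 0 | Suc X \<Rightarrow> Suc (r X)) =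
        case_nat 0 (\<lambda>X. Suc (r (r' X)))"
    by (auto split: nat.split)
  then show ?case by (simp add: AllS)
qed (auto simp: subst_tm_subst_tm)

section \<open>Free variables, universal closures and substitution in derivations\<close>

primrec tm_bound :: "tm \<Rightarrow> nat" where
  "tm_bound (Var n) = Suc n"
| "tm_bound Zero = 0"
| "tm_bound One = 0"
| "tm_bound (Plus t u) = max (tm_bound t) (tm_bound u)"
| "tm_bound (Times t u) = max (tm_bound t) (tm_bound u)"

text \<open>Binders do not lower the bound, so it strictly exceeds all free variables of both sorts but
  need not be optimal.\<close>

primrec fm_bound :: "fm \<Rightarrow> nat" where
  "fm_bound Bot = 0"
| "fm_bound (t \<^bold>= u) = max (tm_bound t) (tm_bound u)"
| "fm_bound (t \<^bold>< u) = max (tm_bound t) (tm_bound u)"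
| "fm_bound (t \<^bold>\<in> X) = max (tm_bound t) (Suc X)"
| "fm_bound (p \<^bold>\<longrightarrow> q) = max (fm_bound p) (fm_bound q)"
| "fm_bound (AllN p) = fm_bound p"
| "fm_bound (AllS p) = fm_bound p"

lemma subst_tm_cong: "(\<And>n. n < tm_bound t \<Longrightarrow> s n = s' n) \<Longrightarrow> subst_tm s t = subst_tm s' t"
  by (induction t) auto

lemma subst_cong:
  "(\<And>n. n < fm_bound p \<Longrightarrow> s n = s' n) \<Longrightarrow> (\<And>n. n < fm_bound p \<Longrightarrow> r n = r' n) \<Longrightarrow>
   subst s r p = subst s' r' p"
proof (induction p arbitrary: s s' r r')
  case (AllN p)
  show ?case using AllN.prems by (auto intro!: AllN.IH split: nat.split)
next
  case (AllS p)
  show ?case using AllS.prems by (auto intro!: AllS.IH split: nat.split)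
next
  case (Imp p q)
  have "subst s r p = subst s' r' p" "subst s r q = subst s' r' q"
    using Imp.prems by (auto intro!: Imp.IH)
  then show ?case by simp
qed (auto intro!: subst_tm_cong)

text \<open>Closedness is expressed as invariance under every substitution, which is the form that
  \<open>derives_subst\<close> uses at an axiom.\<close>

definition closed_fm :: "fm \<Rightarrow> bool"
  where "closed_fm p \<longleftrightarrow> (\<forall>s r. subst s r p = p)"

definition closure :: "fm \<Rightarrow> fm"
  where "closure p = (AllN ^^ fm_bound p) ((AllS ^^ fm_bound p) p)"

text \<open>A substitution pushed under k binders fixes the k innermost variables. With k the bound
  of the formula, it changes no free variable of the matrix.\<close>

lemma subst_AllN_pow:
  "\<exists>s'. (\<forall>n<k. s' n = Var n) \<and> (\<forall>q. subst s r ((AllN ^^ k) q) = (AllN ^^ k) (subst s' r q))"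
proof (induction k)
  case (Suc k)
  then obtain s' where s': "\<forall>n<k. s' n = Var n"
    "\<forall>q. subst s r ((AllN ^^ k) q) = (AllN ^^ k) (subst s' r q)" by blast
  let ?s = "case_nat (Var 0) (\<lambda>n. lift_tm (s' n))"
  have "subst s r ((AllN ^^ Suc k) q) = (AllN ^^ Suc k) (subst ?s r q)" for q
    using s'(2)[rule_format, of "AllN q"] by (simp add: funpow_swap1)
  moreover have "\<forall>n<Suc k. ?s n = Var n"
    using s'(1) by (auto split: nat.split)
  ultimately show ?case by blast
qed auto

lemma subst_AllS_pow:
  "\<exists>r'. (\<forall>n<k. r' n = n) \<and> (\<forall>q. subst s r ((AllS ^^ k) q) = (AllS ^^ k) (subst s r' q))"
proof (induction k)
  case (Suc k)
  then obtain r' where r': "\<forall>n<k. r' n = n"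
    "\<forall>q. subst s r ((AllS ^^ k) q) = (AllS ^^ k) (subst s r' q)" by blast
  let ?r = "case_nat 0 (\<lambda>n. Suc (r' n))"
  have "subst s r ((AllS ^^ Suc k) q) = (AllS ^^ Suc k) (subst s ?r q)" for q
    using r'(2)[rule_format, of "AllS q"] by (simp add: funpow_swap1)
  moreover have "\<forall>n<Suc k. ?r n = n"
    using r'(1) by (auto split: nat.split)
  ultimately show ?case by blast
qed auto

lemma closed_closure: "closed_fm (closure p)"
  unfolding closed_fm_def
proof (intro allI)
  fix s r
  obtain s' where s': "\<forall>n<fm_bound p. s' n = Var n"
    "\<forall>q. subst s r ((AllN ^^ fm_bound p) q) = (AllN ^^ fm_bound p) (subst s' r q)"
    using subst_AllN_pow by blast
  obtain r' where r': "\<forall>n<fm_bound p. r' n = n"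
    "\<forall>q. subst s' r ((AllS ^^ fm_bound p) q) = (AllS ^^ fm_bound p) (subst s' r' q)"
    using subst_AllS_pow by blast
  have "subst s' r' p = subst Var (\<lambda>X. X) p"
    using s'(1) r'(1) by (intro subst_cong) auto
  then show "subst s r (closure p) = closure p"
    by (simp add: closure_def s'(2) r'(2))
qed

lemma derives_weaken: "derives T G p \<Longrightarrow> set G \<subseteq> set G' \<Longrightarrow> derives T G' p"
proof (induction arbitrary: G' rule: derives.induct)
  case (Imp_I p G q)
  show ?case by (rule derives.Imp_I, rule Imp_I.IH) (use Imp_I.prems in auto)
next
  case (Classical p G)
  show ?case by (rule derives.Classical, rule Classical.IH) (use Classical.prems in auto)
next
  case (AllN_I G p)
  show ?case by (rule derives.AllN_I, rule AllN_I.IH) (use AllN_I.prems in auto)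
next
  case (AllS_I G p)
  show ?case by (rule derives.AllS_I, rule AllS_I.IH) (use AllS_I.prems in auto)
next
  case (Eq_subst G t u p)
  show ?case by (rule derives.Eq_subst[of _ _ t]) (use Eq_subst in auto)
qed (auto intro: derives.intros)

lemma derives_closure:
  assumes "derives T [] p" shows "derives T [] (closure p)"
proof -
  have S: "derives T [] ((AllS ^^ k) p)" for k
    by (induction k) (use assms derives.AllS_I[of T "[]"] in auto)
  have "derives T [] ((AllN ^^ k) ((AllS ^^ l) p))" for k l
    by (induction k) (use S derives.AllN_I[of T "[]"] in auto)
  then show ?thesis by (simp add: closure_def)
qed

lemma derives_theorems:
  assumes "derives T' G p" and "\<And>q. q \<in> T' \<Longrightarrow> derives T [] q"
  shows "derives T G p"
  using assms
proof (induction rule: derives.induct)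
  case (Axiom p G)
  then show ?case using derives_weaken by fastforce
qed (auto intro: derives.intros)

text \<open>An open axiom stands for its closure and is not preserved by substitution, so the axioms
  have to be closed; the completeness proof therefore works with the closures of the axioms.\<close>

lemma derives_subst:
  assumes "derives T G p" and "\<forall>q\<in>T. closed_fm q"
  shows "derives T (map (subst s r) G) (subst s r p)"
  using assms
proof (induction arbitrary: s r rule: derives.induct)
  case (Axiom p G)
  then have "subst s r p = p" by (simp add: closed_fm_def)
  with Axiom show ?case by (auto intro: derives.Axiom)
next
  case (Assm p G)
  then show ?case by (auto intro: derives.Assm)
next
  case (Imp_I p G q)
  then show ?case by (auto intro: derives.Imp_I)
next
  case (Imp_E G p q)
  have "derives T (map (subst s r) G) (subst s r p \<^bold>\<longrightarrow> subst s r q)"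
    using Imp_E.IH(1)[OF Imp_E.prems, of s r] by simp
  then show ?case using Imp_E.IH(2)[OF Imp_E.prems, of s r] by (rule derives.Imp_E)
next
  case (Classical p G)
  have "derives T ((\<^bold>\<not> subst s r p) # map (subst s r) G) Bot"
    using Classical.IH[OF Classical.prems, of s r] by simp
  then show ?case by (rule derives.Classical)
next
  case (AllN_I G p)
  let ?s = "case_nat (Var 0) (\<lambda>n. lift_tm (s n))"
  have "derives T (map liftN (map (subst s r) G)) (subst ?s r p)"
    using AllN_I.IH[OF AllN_I.prems, of ?s r] by (simp add: subst_subst comp_def)
  then show ?case by (auto intro: derives.AllN_I)
next
  case (AllS_I G p)
  let ?r = "case_nat 0 (\<lambda>n. Suc (r n))"
  have "derives T (map liftS (map (subst s r) G)) (subst s ?r p)"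
    using AllS_I.IH[OF AllS_I.prems, of s ?r] by (simp add: subst_subst comp_def)
  then show ?case by (auto intro: derives.AllS_I)
next
  case (AllN_E G p t)
  have "derives T (map (subst s r) G) (AllN (subst (case_nat (Var 0) (\<lambda>n. lift_tm (s n))) r p))"
    using AllN_E.IH[OF AllN_E.prems, of s r] by simp
  from derives.AllN_E[OF this, of "subst_tm s t"] show ?case
    by (rule back_subst) (auto simp: subst_subst subst_tm_subst_tm intro!: subst_cong split: nat.split)
next
  case (AllS_E G p X)
  have "derives T (map (subst s r) G) (AllS (subst s (case_nat 0 (\<lambda>n. Suc (r n))) p))"
    using AllS_E.IH[OF AllS_E.prems, of s r] by simp
  from derives.AllS_E[OF this, of "r X"] show ?case
    by (rule back_subst) (auto simp: subst_subst intro!: subst_cong split: nat.split)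
next
  case (Eq_refl G t)
  then show ?case by (auto intro: derives.Eq_refl)
next
  case (Eq_subst G t u p)
  let ?s = "case_nat (Var 0) (\<lambda>n. lift_tm (s n))"
  have inst: "subst s r (instN t p) = instN (subst_tm s t) (subst ?s r p)" for t
    by (auto simp: subst_subst subst_tm_subst_tm intro!: subst_cong split: nat.split)
  show ?case
    using Eq_subst.IH[OF Eq_subst.prems, of s r] derives.Eq_subst unfolding inst by auto
qed

section \<open>Completeness\<close>

instance tm :: countable by countable_datatype
instance fm :: countable by countable_datatype

text \<open>A variable not free in \<open>p\<close> or \<open>G\<close> serves as a Henkin constant.
  Renaming it to index 0 and shifting the others turns the derivation into one to which
  \<open>AllN_I\<close> applies.\<close>

lemma derives_AllN_fresh:
  assumes T: "\<forall>q\<in>T. closed_fm q"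
    and fresh: "\<And>q. q \<in> set (p # G) \<Longrightarrow> fm_bound q \<le> x"
    and der: "derives T G (instN (Var x) p)"
  shows "derives T G (AllN p)"
proof (rule derives.AllN_I)
  let ?s = "\<lambda>y. if y = x then Var 0 else Var (Suc y)"
  have "map (subst ?s (\<lambda>X. X)) G = map liftN G"
    using fresh by (fastforce intro: subst_cong)
  moreover have "subst ?s (\<lambda>X. X) (instN (Var x) p) = subst Var (\<lambda>X. X) p"
    unfolding subst_subst using fresh[of p] by (intro subst_cong) (auto split: nat.split)
  ultimately show "derives T (map liftN G) p"
    using derives_subst[OF der T, where s = ?s and r = "\<lambda>X. X"] by (simp only: subst_id)
qed

lemma derives_AllS_fresh:
  assumes T: "\<forall>q\<in>T. closed_fm q"
    and fresh: "\<And>q. q \<in> set (p # G) \<Longrightarrow> fm_bound q \<le> X"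
    and der: "derives T G (instS X p)"
  shows "derives T G (AllS p)"
proof (rule derives.AllS_I)
  let ?r = "\<lambda>Y. if Y = X then 0 else Suc Y"
  have "map (subst Var ?r) G = map liftS G"
    using fresh by (fastforce intro: subst_cong)
  moreover have "subst Var ?r (instS X p) = subst Var (\<lambda>X. X) p"
    unfolding subst_subst using fresh[of p] by (intro subst_cong) (auto split: nat.split)
  ultimately show "derives T (map liftS G) p"
    using derives_subst[OF der T, where s = Var and r = ?r] by (simp only: subst_id)
qed

lemma derives_cut: "derives T G p \<Longrightarrow> derives T (p # G) q \<Longrightarrow> derives T G q"
  by (blast intro: derives.Imp_I derives.Imp_E)

section \<open>Maximal consistent sets with witnesses\<close>

locale henkin =
  fixes T :: "fm set" and H :: "fm set"
  assumes consistent: "set G \<subseteq> H \<Longrightarrow> \<not> derives T G Bot"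
    and complete: "p \<in> H \<or> (\<^bold>\<not> p) \<in> H"
    and witnessN: "AllN p \<notin> H \<Longrightarrow> \<exists>t. (\<^bold>\<not> instN t p) \<in> H"
    and witnessS: "AllS p \<notin> H \<Longrightarrow> \<exists>X. (\<^bold>\<not> instS X p) \<in> H"

text \<open>If \<open>p\<close> is inconsistent with \<open>G\<close>, its negation is added,
  together with a counterexample when \<open>p\<close> is universal. The counterexample at a fresh
  variable is consistent, since otherwise \<open>p\<close> would be derivable. The assumptions stay
  a finite list, so a fresh variable always exists and the language does not grow.\<close>

lemma henkin_extension_step:
  assumes T: "\<forall>q\<in>T. closed_fm q" and con: "\<not> derives T G Bot"
  shows "\<exists>G'. \<not> derives T G' Bot \<and> set G \<subseteq> set G' \<and>
    (p \<in> set G' \<or> (\<^bold>\<not> p) \<in> set G' \<and>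
      (\<forall>q. p = AllN q \<longrightarrow> (\<exists>t. (\<^bold>\<not> instN t q) \<in> set G')) \<and>
      (\<forall>q. p = AllS q \<longrightarrow> (\<exists>X. (\<^bold>\<not> instS X q) \<in> set G')))"
proof (cases "derives T (p # G) Bot")
  case False
  then show ?thesis by (intro exI[of _ "p # G"]) auto
next
  case True
  let ?G = "(\<^bold>\<not> p) # G"
  have neg: "derives T G (\<^bold>\<not> p)"
    using True by (rule derives.Imp_I)
  have con': "\<not> derives T ?G Bot"
    using con neg derives_cut by blast
  have np: "derives T ?G (\<^bold>\<not> p)"
    by (simp add: derives.Assm)
  define x where "x = Max (fm_bound ` set (p # ?G))"
  have bound: "fm_bound q \<le> x" if "q \<in> set (p # ?G)" for q
    unfolding x_def using that by (intro Max_ge) auto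
  show ?thesis
  proof (cases "(\<exists>q. p = AllN q) \<or> (\<exists>q. p = AllS q)")
    case False
    then show ?thesis using con' by (intro exI[of _ ?G]) auto
  next
    case True
    then obtain q where "p = AllN q \<or> p = AllS q" by blast
    then show ?thesis
    proof
      assume p: "p = AllN q"
      have "\<not> derives T ((\<^bold>\<not> instN (Var x) q) # ?G) Bot"
      proof
        assume "derives T ((\<^bold>\<not> instN (Var x) q) # ?G) Bot"
        then have "derives T ?G (instN (Var x) q)" by (rule derives.Classical)
        then have "derives T ?G p"
          unfolding p by (rule derives_AllN_fresh[OF T, rotated]) (use bound bound[of p] p in auto)
        then show False using con' np derives.Imp_E by blast
      qed
      then show ?thesis using p by (intro exI[of _ "(\<^bold>\<not> instN (Var x) q) # ?G"]) auto
    next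
      assume p: "p = AllS q"
      have "\<not> derives T ((\<^bold>\<not> instS x q) # ?G) Bot"
      proof
        assume "derives T ((\<^bold>\<not> instS x q) # ?G) Bot"
        then have "derives T ?G (instS x q)" by (rule derives.Classical)
        then have "derives T ?G p"
          unfolding p by (rule derives_AllS_fresh[OF T, rotated]) (use bound bound[of p] p in auto)
        then show False using con' np derives.Imp_E by blast
      qed
      then show ?thesis using p by (intro exI[of _ "(\<^bold>\<not> instS x q) # ?G"]) auto
    qed
  qed
qed

lemma henkin_extension:
  assumes T: "\<forall>q\<in>T. closed_fm q" and con: "\<not> derives T G Bot"
  shows "\<exists>H. set G \<subseteq> H \<and> henkin T H"
proof -
  \<comment> \<open>Stage n decides the formula with code n.\<close>
  define R where "R n G G' \<longleftrightarrow> set G \<subseteq> set G' \<and>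
    (from_nat n \<in> set G' \<or> (\<^bold>\<not> from_nat n) \<in> set G' \<and>
      (\<forall>q. from_nat n = AllN q \<longrightarrow> (\<exists>t. (\<^bold>\<not> instN t q) \<in> set G')) \<and>
      (\<forall>q. from_nat n = AllS q \<longrightarrow> (\<exists>X. (\<^bold>\<not> instS X q) \<in> set G')))" for n and G G' :: "fm list"
  have "\<exists>f. f 0 = G \<and> (\<forall>n. \<not> derives T (f n) Bot \<and> R n (f n) (f (Suc n)))"
  proof -
    have "\<exists>f. \<forall>n. (\<not> derives T (f n) Bot \<and> (n = 0 \<longrightarrow> f n = G)) \<and> R n (f n) (f (Suc n))"
    proof (rule dependent_nat_choice)
      show "\<exists>G'. \<not> derives T G' Bot \<and> (0 = 0 \<longrightarrow> G' = G)" using con by blast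
      show "\<exists>G''. (\<not> derives T G'' Bot \<and> (Suc n = 0 \<longrightarrow> G'' = G)) \<and> R n G' G''"
        if "\<not> derives T G' Bot \<and> (n = 0 \<longrightarrow> G' = G)" for G' n
        unfolding R_def using henkin_extension_step[OF T, of G' "from_nat n"] that by blast
    qed
    then show ?thesis by blast
  qed
  then obtain f where f: "f 0 = G" "\<And>n. \<not> derives T (f n) Bot" "\<And>n. R n (f n) (f (Suc n))"
    by blast
  define H where "H = (\<Union>n. set (f n))"
  have mono: "set (f m) \<subseteq> set (f n)" if "m \<le> n" for m n
    using that by (induction rule: dec_induct) (use f(3) R_def in blast)+
  \<comment> \<open>Compactness: a finite list from \<open>H\<close> already lies in one stage, so
    \<open>H\<close> inherits consistency.\<close>
  have fin: "\<exists>n. set L \<subseteq> set (f n)" if "set L \<subseteq> H" for L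
    using that
  proof (induction L)
    case (Cons p L)
    then obtain m n where "p \<in> set (f m)" "set L \<subseteq> set (f n)"
      unfolding H_def by auto
    then have "set (p # L) \<subseteq> set (f (max m n))"
      using mono[of m "max m n"] mono[of n "max m n"] by auto
    then show ?case by blast
  qed auto
  have decided: "p \<in> H \<or> (\<^bold>\<not> p) \<in> H \<and>
      (\<forall>q. p = AllN q \<longrightarrow> (\<exists>t. (\<^bold>\<not> instN t q) \<in> H)) \<and>
      (\<forall>q. p = AllS q \<longrightarrow> (\<exists>X. (\<^bold>\<not> instS X q) \<in> H))" for p
    using f(3)[of "to_nat p"] unfolding R_def H_def by (simp del: split_paired_Ex) blast
  have "henkin T H"
  proof
    show "\<not> derives T L Bot" if "set L \<subseteq> H" for L
      using fin[OF that] f(2) derives_weaken by blast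
  qed (use decided in blast)+
  moreover have "set G \<subseteq> H" using f(1) unfolding H_def by blast
  ultimately show ?thesis by blast
qed

context henkin
begin

lemma deductively_closed:
  assumes "derives T G p" "set G \<subseteq> H" shows "p \<in> H"
proof (rule ccontr)
  assume "p \<notin> H"
  then have "(\<^bold>\<not> p) \<in> H" using complete by blast
  then have "set ((\<^bold>\<not> p) # G) \<subseteq> H" using assms(2) by simp
  moreover have "derives T ((\<^bold>\<not> p) # G) Bot"
    by (rule derives.Imp_E[of _ _ p]) (auto intro: derives.Assm derives_weaken[OF assms(1)])
  ultimately show False using consistent by blast
qed

lemma Bot_notin: "Bot \<notin> H"
  using consistent[of "[Bot]"] derives.Assm[of Bot "[Bot]"] by auto

lemma Imp_iff: "(p \<^bold>\<longrightarrow> q) \<in> H \<longleftrightarrow> (p \<in> H \<longrightarrow> q \<in> H)"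
proof
  assume "(p \<^bold>\<longrightarrow> q) \<in> H"
  moreover have "derives T [p \<^bold>\<longrightarrow> q, p] q"
    by (rule derives.Imp_E[of _ _ p]) (auto intro: derives.Assm)
  ultimately show "p \<in> H \<longrightarrow> q \<in> H"
    using deductively_closed[of "[p \<^bold>\<longrightarrow> q, p]" q] by auto
next
  assume pq: "p \<in> H \<longrightarrow> q \<in> H"
  show "(p \<^bold>\<longrightarrow> q) \<in> H"
  proof (cases "p \<in> H")
    case True
    have "derives T [q] (p \<^bold>\<longrightarrow> q)"
      by (rule derives.Imp_I) (simp add: derives.Assm)
    then show ?thesis using deductively_closed[of "[q]"] True pq by auto
  next
    case False
    then have "(\<^bold>\<not> p) \<in> H" using complete by blast
    moreover have "derives T ((\<^bold>\<not> q) # p # [\<^bold>\<not> p]) Bot"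
      by (rule derives.Imp_E[of _ _ p]) (auto intro: derives.Assm)
    then have "derives T [\<^bold>\<not> p] (p \<^bold>\<longrightarrow> q)"
      by (blast intro: derives.Imp_I derives.Classical)
    ultimately show ?thesis using deductively_closed[of "[\<^bold>\<not> p]"] by auto
  qed
qed

lemma Neg_iff: "(\<^bold>\<not> p) \<in> H \<longleftrightarrow> p \<notin> H"
  using Imp_iff Bot_notin by simp

lemma AllN_iff: "AllN p \<in> H \<longleftrightarrow> (\<forall>t. instN t p \<in> H)"
proof
  show "\<forall>t. instN t p \<in> H" if "AllN p \<in> H"
    using that deductively_closed[of "[AllN p]"] derives.AllN_E[of T "[AllN p]"] by (simp add: derives.Assm)
  show "AllN p \<in> H" if "\<forall>t. instN t p \<in> H"
    using that witnessN[of p] Neg_iff by blast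
qed

lemma AllS_iff: "AllS p \<in> H \<longleftrightarrow> (\<forall>X. instS X p \<in> H)"
proof
  show "\<forall>X. instS X p \<in> H" if "AllS p \<in> H"
    using that deductively_closed[of "[AllS p]"] derives.AllS_E[of T "[AllS p]"] by (simp add: derives.Assm)
  show "AllS p \<in> H" if "\<forall>X. instS X p \<in> H"
    using that witnessS[of p] Neg_iff by blast
qed

lemma Eq_refl: "(t \<^bold>= t) \<in> H"
  using deductively_closed[of "[]"] derives.Eq_refl by auto

lemma Eq_subst: "(t \<^bold>= u) \<in> H \<Longrightarrow> instN t p \<in> H \<Longrightarrow> instN u p \<in> H"
  by (rule deductively_closed[of "[t \<^bold>= u, instN t p]"], rule derives.Eq_subst)
    (auto intro: derives.Assm)

lemma Eq_sym: "(t \<^bold>= u) \<in> H \<Longrightarrow> (u \<^bold>= t) \<in> H"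
  using Eq_subst[of t u "Var 0 \<^bold>= lift_tm t"] Eq_refl by (simp add: subst_tm_subst_tm)

lemma Eq_trans: "(t \<^bold>= u) \<in> H \<Longrightarrow> (u \<^bold>= v) \<in> H \<Longrightarrow> (t \<^bold>= v) \<in> H"
  using Eq_subst[of u v "lift_tm t \<^bold>= Var 0"] by (simp add: subst_tm_subst_tm)

lemma Plus_cong: "(t \<^bold>= t') \<in> H \<Longrightarrow> (u \<^bold>= u') \<in> H \<Longrightarrow> (Plus t u \<^bold>= Plus t' u') \<in> H"
  using Eq_subst[of t t' "lift_tm (Plus t u) \<^bold>= Plus (Var 0) (lift_tm u)"]
    Eq_subst[of u u' "lift_tm (Plus t u) \<^bold>= Plus (lift_tm t') (Var 0)"] Eq_refl
  by (simp add: subst_tm_subst_tm)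

lemma Times_cong: "(t \<^bold>= t') \<in> H \<Longrightarrow> (u \<^bold>= u') \<in> H \<Longrightarrow> (Times t u \<^bold>= Times t' u') \<in> H"
  using Eq_subst[of t t' "lift_tm (Times t u) \<^bold>= Times (Var 0) (lift_tm u)"]
    Eq_subst[of u u' "lift_tm (Times t u) \<^bold>= Times (lift_tm t') (Var 0)"] Eq_refl
  by (simp add: subst_tm_subst_tm)

lemma Less_cong: "(t \<^bold>= t') \<in> H \<Longrightarrow> (u \<^bold>= u') \<in> H \<Longrightarrow> (t \<^bold>< u) \<in> H \<Longrightarrow> (t' \<^bold>< u') \<in> H"
  using Eq_subst[of t t' "Var 0 \<^bold>< lift_tm u"] Eq_subst[of u u' "lift_tm t' \<^bold>< Var 0"]
  by (simp add: subst_tm_subst_tm)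

lemma Mem_cong: "(t \<^bold>= t') \<in> H \<Longrightarrow> (t \<^bold>\<in> X) \<in> H \<Longrightarrow> (t' \<^bold>\<in> X) \<in> H"
  using Eq_subst[of t t' "Var 0 \<^bold>\<in> X"] by simp

text \<open>Undoes one quantifier of a closure: \<open>s 0\<close> instantiates the bound variable,
  and the terms \<open>s (Suc n)\<close> go to the variables outside it.\<close>

lemma subst_AllN_D:
  assumes "\<And>s r. subst s r (AllN p) \<in> H" shows "subst s r p \<in> H"
proof -
  have "instN (s 0) (subst (case_nat (Var 0) (\<lambda>n. lift_tm (s (Suc n)))) r p) \<in> H"
    using assms[of "\<lambda>n. s (Suc n)" r] AllN_iff by simp
  also have "instN (s 0) (subst (case_nat (Var 0) (\<lambda>n. lift_tm (s (Suc n)))) r p) = subst s r p"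
    unfolding subst_subst by (rule subst_cong) (auto simp: subst_tm_subst_tm split: nat.split)
  finally show ?thesis .
qed

lemma subst_AllS_D:
  assumes "\<And>s r. subst s r (AllS p) \<in> H" shows "subst s r p \<in> H"
proof -
  have "instS (r 0) (subst s (case_nat 0 (\<lambda>n. Suc (r (Suc n)))) p) \<in> H"
    using assms[of s "\<lambda>n. r (Suc n)"] AllS_iff by simp
  also have "instS (r 0) (subst s (case_nat 0 (\<lambda>n. Suc (r (Suc n)))) p) = subst s r p"
    unfolding subst_subst by (rule subst_cong) (auto simp: subst_tm_subst_tm split: nat.split)
  finally show ?thesis .
qed

lemma subst_closure_D:
  assumes "closure p \<in> H" shows "subst s r p \<in> H"
proof -
  have S: "subst s r q \<in> H" if "\<And>s r. subst s r ((AllS ^^ k) q) \<in> H" for k q s r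
    using that
  proof (induction k arbitrary: q s r)
    case (Suc k)
    show ?case by (rule subst_AllS_D, rule Suc.IH) (use Suc.prems in \<open>simp add: funpow_swap1\<close>)
  qed auto
  have N: "subst s r q \<in> H" if "\<And>s r. subst s r ((AllN ^^ k) q) \<in> H" for k q s r
    using that
  proof (induction k arbitrary: q s r)
    case (Suc k)
    show ?case by (rule subst_AllN_D, rule Suc.IH) (use Suc.prems in \<open>simp add: funpow_swap1\<close>)
  qed auto
  have "subst s r (closure p) \<in> H" for s r
    using closed_closure assms by (simp add: closed_fm_def)
  then show ?thesis
    unfolding closure_def using S[of "fm_bound p" p] N[of "fm_bound p" "(AllS ^^ fm_bound p) p"] by blast
qed

end

section \<open>Second-order structures and the term model\<close>

locale so_structure =
  fixes zr on :: 'a and pl ti :: "'a \<Rightarrow> 'a \<Rightarrow> 'a" and ls :: "'a \<Rightarrow> 'a \<Rightarrow> bool"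
    and sets :: "'a set set"
begin

primrec eval :: "(nat \<Rightarrow> 'a) \<Rightarrow> tm \<Rightarrow> 'a" where
  "eval e (Var n) = e n"
| "eval e Zero = zr"
| "eval e One = on"
| "eval e (Plus t u) = pl (eval e t) (eval e u)"
| "eval e (Times t u) = ti (eval e t) (eval e u)"

primrec sat :: "(nat \<Rightarrow> 'a) \<Rightarrow> (nat \<Rightarrow> 'a set) \<Rightarrow> fm \<Rightarrow> bool" where
  "sat e E Bot \<longleftrightarrow> False"
| "sat e E (t \<^bold>= u) \<longleftrightarrow> eval e t = eval e u"
| "sat e E (t \<^bold>< u) \<longleftrightarrow> ls (eval e t) (eval e u)"
| "sat e E (t \<^bold>\<in> X) \<longleftrightarrow> eval e t \<in> E X"
| "sat e E (p \<^bold>\<longrightarrow> q) \<longleftrightarrow> (sat e E p \<longrightarrow> sat e E q)"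
| "sat e E (AllN p) \<longleftrightarrow> (\<forall>a. sat (case_nat a e) E p)"
| "sat e E (AllS p) \<longleftrightarrow> (\<forall>A\<in>sets. sat e (case_nat A E) p)"

definition models :: "fm set \<Rightarrow> bool"
  where "models T \<longleftrightarrow> (\<forall>q\<in>T. \<forall>e E. (\<forall>X. E X \<in> sets) \<longrightarrow> sat e E q)"

lemma eval_subst: "eval e (subst_tm s t) = eval (\<lambda>n. eval e (s n)) t"
  by (induction t) auto

lemma sat_subst: "sat e E (subst s r p) \<longleftrightarrow> sat (\<lambda>n. eval e (s n)) (\<lambda>X. E (r X)) p"
proof (induction p arbitrary: s r e E)
  case (AllN p)
  have "(\<lambda>n. eval (case_nat a e) (case_nat (Var 0) (\<lambda>n. lift_tm (s n)) n)) =
        case_nat a (\<lambda>n. eval e (s n))" for a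
    by (auto simp: eval_subst split: nat.split)
  then show ?case by (simp add: AllN)
next
  case (AllS p)
  have "(\<lambda>X. case_nat A E (case_nat 0 (\<lambda>n. Suc (r n)) X)) = case_nat A (\<lambda>X. E (r X))" for A
    by (rule ext) (auto split: nat.split)
  then show ?case by (simp add: AllS)
qed (auto simp: eval_subst)

end

text \<open>The axioms for the successor make the numerals pairwise distinct, so the domain is countably
  infinite and can be taken to be the whole type \<open>nat\<close>.\<close>

lemma henkin_model:
  assumes H: "henkin T H" and ax: "\<And>q s r. q \<in> basic_axioms \<Longrightarrow> subst s r q \<in> H"
  shows "\<exists>zr on pl ti ls sets (val :: tm \<Rightarrow> nat) ext. surj val \<and> sets = range ext \<and>
    (\<forall>p s r. so_structure.sat zr on pl ti ls sets (\<lambda>n. val (s n)) (\<lambda>X. ext (r X)) p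
      \<longleftrightarrow> subst s r p \<in> H)"
proof -
  interpret henkin T H by (rule H)
  define cls where "cls t = {u. (t \<^bold>= u) \<in> H}" for t
  have cls: "cls t = cls u \<longleftrightarrow> (t \<^bold>= u) \<in> H" for t u
    unfolding cls_def using Eq_refl Eq_sym Eq_trans by blast
  define num where "num n = ((\<lambda>t. Plus t One) ^^ n) Zero" for n
  have num0: "num 0 = Zero" and numS: "num (Suc n) = Plus (num n) One" for n
    by (simp_all add: num_def)
  have succ_nz: "(Plus t One \<^bold>= Zero) \<notin> H" for t
    using ax[of "\<^bold>\<not> (Plus (Var 1) One \<^bold>= Zero)" "\<lambda>_. t"] Neg_iff
    by (simp add: basic_axioms_def Let_def)
  have succ_inj: "(Plus t One \<^bold>= Plus u One) \<in> H \<Longrightarrow> (t \<^bold>= u) \<in> H" for t u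
    using ax[of "(Plus (Var 0) One \<^bold>= Plus (Var 1) One) \<^bold>\<longrightarrow> (Var 0 \<^bold>= Var 1)" "case_nat t (\<lambda>_. u)"] Imp_iff
    by (simp add: basic_axioms_def Let_def)
  have "(num m \<^bold>= num n) \<in> H \<Longrightarrow> m = n" for m n
  proof (induction m arbitrary: n)
    case 0
    then show ?case using succ_nz Eq_sym by (cases n) (auto simp: num0 numS)
  next
    case (Suc m)
    then show ?case using succ_nz succ_inj by (cases n) (auto simp: num0 numS)
  qed
  then have "inj (\<lambda>n. cls (num n))"
    by (auto simp: inj_def cls)
  then have "infinite (range cls)"
    using finite_subset[of "range (\<lambda>n. cls (num n))" "range cls"] finite_imageD by blast
  then obtain b :: "tm set \<Rightarrow> nat" where b: "bij_betw b (range cls) UNIV"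
    using countableE_infinite[of "range cls"] by auto
  define val where "val t = b (cls t)" for t
  have val: "val t = val u \<longleftrightarrow> (t \<^bold>= u) \<in> H" for t u
    using b cls by (metis val_def bij_betw_def inj_on_eq_iff rangeI)
  have surj: "surj val"
    using b by (auto simp: val_def bij_betw_def surj_def image_iff)
  define rep where "rep = inv_into UNIV val"
  have rep: "(rep (val t) \<^bold>= t) \<in> H" for t
    using val surj by (metis rep_def surj_f_inv_f)
  define pl where "pl a b = val (Plus (rep a) (rep b))" for a b
  define ti where "ti a b = val (Times (rep a) (rep b))" for a b
  define ls where "ls a b \<longleftrightarrow> (rep a \<^bold>< rep b) \<in> H" for a b
  \<comment> \<open>As the language has no equality of sets, a set variable can be interpreted by
    its extension; different variables may then share one set.\<close>
  define ext where "ext X = {a. (rep a \<^bold>\<in> X) \<in> H}" for X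
  have all: "(\<forall>a. P a) \<longleftrightarrow> (\<forall>t. P (val t))" for P
    using surj by (metis surjD)
  interpret M: so_structure "val Zero" "val One" pl ti ls "range ext" .
  have pl: "pl (val t) (val u) = val (Plus t u)" and ti: "ti (val t) (val u) = val (Times t u)" for t u
    unfolding pl_def ti_def val by (intro Plus_cong Times_cong rep)+
  have eval: "M.eval (\<lambda>n. val (s n)) t = val (subst_tm s t)" for s t
    by (induction t) (simp_all add: pl ti)
  have ls: "ls (val t) (val u) \<longleftrightarrow> (t \<^bold>< u) \<in> H" for t u
    unfolding ls_def using Less_cong rep Eq_sym by blast
  have ext: "val t \<in> ext X \<longleftrightarrow> (t \<^bold>\<in> X) \<in> H" for t X
    unfolding ext_def using Mem_cong rep Eq_sym by blast
  have "M.sat (\<lambda>n. val (s n)) (\<lambda>X. ext (r X)) p \<longleftrightarrow> subst s r p \<in> H" for p s r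
  proof (induction p arbitrary: s r)
    case (AllN p)
    have 1: "case_nat (val t) (\<lambda>n. val (s n)) = (\<lambda>n. val (case_nat t s n))" for t
      by (auto split: nat.split)
    have 2: "instN t (subst (case_nat (Var 0) (\<lambda>n. lift_tm (s n))) r p) = subst (case_nat t s) r p" for t
      unfolding subst_subst by (rule subst_cong) (auto simp: subst_tm_subst_tm split: nat.split)
    have "M.sat (\<lambda>n. val (s n)) (\<lambda>X. ext (r X)) (AllN p) \<longleftrightarrow>
        (\<forall>t. M.sat (case_nat (val t) (\<lambda>n. val (s n))) (\<lambda>X. ext (r X)) p)"
      using all by simp
    then show ?case by (simp add: 1 AllN AllN_iff 2)
  next
    case (AllS p)
    have 1: "case_nat (ext Y) (\<lambda>X. ext (r X)) = (\<lambda>X. ext (case_nat Y r X))" for Y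
      by (simp add: fun_eq_iff split: nat.split)
    have 2: "instS Y (subst s (case_nat 0 (\<lambda>n. Suc (r n))) p) = subst s (case_nat Y r) p" for Y
      unfolding subst_subst by (rule subst_cong) (auto simp: subst_tm_subst_tm split: nat.split)
    show ?case by (simp add: 1 AllS AllS_iff 2)
  qed (auto simp: eval val ls ext Bot_notin Imp_iff)
  then have "surj val \<and> range ext = range ext \<and>
    (\<forall>p s r. M.sat (\<lambda>n. val (s n)) (\<lambda>X. ext (r X)) p \<longleftrightarrow> subst s r p \<in> H)"
    using surj by blast
  then show ?thesis by (intro exI)
qed

text \<open>A Henkin set containing the negated formula describes the countermodel. The basic axioms
  in \<open>T\<close> make that model infinite, so that its domain can be \<open>nat\<close>;
  closing the axioms makes them true under every assignment.\<close>

theorem completeness: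
  assumes basic: "basic_axioms \<subseteq> T" and unprov: "\<not> (T \<turnstile> p)"
  shows "\<exists>zr on pl ti ls (sets :: nat set set) e E.
    so_structure.models zr on pl ti ls sets T \<and> (\<forall>X. E X \<in> sets) \<and>
    \<not> so_structure.sat zr on pl ti ls sets e E p"
proof -
  let ?T = "closure ` T"
  have closed: "\<forall>q\<in>?T. closed_fm q"
    using closed_closure by blast
  have thms: "derives T [] q" if "q \<in> ?T" for q
    using that derives_closure derives.Axiom by blast
  have "\<not> derives ?T [\<^bold>\<not> p] Bot"
  proof
    assume "derives ?T [\<^bold>\<not> p] Bot"
    then have "derives T [\<^bold>\<not> p] Bot" using thms by (rule derives_theorems)
    then show False using unprov derives.Classical unfolding proves_def by blast
  qed
  then obtain H where H: "henkin ?T H" "(\<^bold>\<not> p) \<in> H"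
    using henkin_extension[OF closed, of "[\<^bold>\<not> p]"] by auto
  interpret henkin ?T H by (rule H)
  have ax: "subst s r q \<in> H" if "q \<in> T" for q s r
    using that deductively_closed[of "[]"] by (intro subst_closure_D) (auto intro: derives.Axiom)
  have "subst s r q \<in> H" if "q \<in> basic_axioms" for q s r
    using ax basic that by blast
  from henkin_model[OF H(1) this]
  obtain zr on pl ti ls sets and val :: "tm \<Rightarrow> nat" and ext where
    M: "surj val" "sets = range ext"
       "\<And>p s r. so_structure.sat zr on pl ti ls sets (\<lambda>n. val (s n)) (\<lambda>X. ext (r X)) p
          \<longleftrightarrow> subst s r p \<in> H"
    by blast
  interpret M: so_structure zr on pl ti ls sets .
  have "M.sat e E q" if "q \<in> T" "\<And>X. E X \<in> sets" for q e E
  proof -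
    \<comment> \<open>Every value is denoted by a term and every set by a set variable, so an
      arbitrary assignment comes from a substitution.\<close>
    have e: "(\<lambda>n. val (inv_into UNIV val (e n))) = e"
      using M(1) by (simp add: surj_f_inv_f)
    have E: "(\<lambda>X. ext (inv_into UNIV ext (E X))) = E"
      using M(2) that(2) by (simp add: f_inv_into_f)
    show ?thesis
      using M(3)[of "\<lambda>n. inv_into UNIV val (e n)" "\<lambda>X. inv_into UNIV ext (E X)" q] ax[OF that(1)] unfolding e E by simp
  qed
  then have "M.models T" unfolding M.models_def by blast
  moreover have "\<not> M.sat (\<lambda>n. val (Var n)) (\<lambda>X. ext X) p"
    using M(3)[of Var "\<lambda>X. X" p] H(2) Neg_iff by simp
  moreover have "\<forall>X. ext X \<in> sets" using M(2) by blast
  ultimately have "M.models T \<and> (\<forall>X. ext X \<in> sets) \<and> \<not> M.sat (\<lambda>n. val (Var n)) (\<lambda>X. ext X) p"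
    by blast
  then show ?thesis by (intro exI)
qed

section \<open>Definable predicates in models of arithmetical comprehension\<close>

definition interleave :: "(nat \<Rightarrow> 'b) \<Rightarrow> (nat \<Rightarrow> 'b) \<Rightarrow> nat \<Rightarrow> 'b"
  where "interleave f g n = (if even n then f (n div 2) else g (n div 2))"

lemma arithmetical_subst [simp]: "arithmetical (subst s r p) \<longleftrightarrow> arithmetical p"
  by (induction p arbitrary: s r) auto

locale aca_model = so_structure zr on pl ti ls sets
  for zr :: 'a  (\<open>\<^bold>0\<close>) and on :: 'a  (\<open>\<^bold>1\<close>)
    and pl :: "'a \<Rightarrow> 'a \<Rightarrow> 'a"  (infixl \<open>\<uplus>\<close> 65)
    and ti :: "'a \<Rightarrow> 'a \<Rightarrow> 'a"  (infixl \<open>\<odot>\<close> 70)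
    and ls :: "'a \<Rightarrow> 'a \<Rightarrow> bool"  (infix \<open>\<prec>\<close> 50)
    and sets :: "'a set set" +
  assumes models_ACA0: "models ACA0" and sets_nonempty: "sets \<noteq> {}"
begin

text \<open>The even variables of the formula hold the arguments \<open>e\<close>, the odd ones parameters from the model;
  this leaves room to merge the parameters of two formulas.\<close>

definition definable :: "((nat \<Rightarrow> 'a) \<Rightarrow> bool) \<Rightarrow> bool" where
  "definable P \<longleftrightarrow> (\<exists>p g E. arithmetical p \<and> (\<forall>X. E X \<in> sets) \<and>
     (\<forall>e. P e \<longleftrightarrow> sat (interleave e g) E p))"

definition dterm :: "((nat \<Rightarrow> 'a) \<Rightarrow> 'a) \<Rightarrow> bool"
  where "dterm t \<longleftrightarrow> (\<exists>u g. \<forall>e. t e = eval (interleave e g) u)"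

text \<open>Arguments keep their even positions. Parameter k sits at n = 2k + 1; in the merged list
  it has index 2k (here) or 2k + 1 (\<open>interleave_right\<close>), hence position 4k + 1 = 2n - 1
  or 4k + 3 = 2n + 1.\<close>

lemma interleave_left:
  "(\<lambda>n. eval (interleave e (interleave g g')) (Var (if even n then n else 2 * n - 1))) = interleave e g"
  "(\<lambda>X. interleave E E' (2 * X)) = E"
proof -
  have "odd (2 * n - 1)" "(2 * n - 1) div 2 = n - 1" "even (n - 1)" "(n - 1) div 2 = n div 2" if "odd n" for n :: nat
    using that by (auto elim!: oddE)
  then show "(\<lambda>n. eval (interleave e (interleave g g')) (Var (if even n then n else 2 * n - 1))) = interleave e g"
    by (simp add: interleave_def fun_eq_iff)
qed (simp add: interleave_def)

lemma interleave_right: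
  "(\<lambda>n. eval (interleave e (interleave g g')) (Var (if even n then n else Suc (2 * n)))) = interleave e g'"
  "(\<lambda>X. interleave E E' (Suc (2 * X))) = E'"
  by (simp_all add: interleave_def fun_eq_iff)

lemma interleave_in_sets:
  "\<forall>X. E X \<in> sets \<Longrightarrow> \<forall>X. E' X \<in> sets \<Longrightarrow> \<forall>X. interleave E E' X \<in> sets"
  by (simp add: interleave_def)

lemma definable_common:
  assumes "definable P" "definable Q"
  obtains p q g E where "arithmetical p" "arithmetical q" "\<forall>X. E X \<in> sets"
    "\<forall>e. P e \<longleftrightarrow> sat (interleave e g) E p" "\<forall>e. Q e \<longleftrightarrow> sat (interleave e g) E q"
proof -
  from assms obtain p g E q g' E' where
    p: "arithmetical p" "\<forall>X. E X \<in> sets" "\<forall>e. P e \<longleftrightarrow> sat (interleave e g) E p" and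
    q: "arithmetical q" "\<forall>X. E' X \<in> sets" "\<forall>e. Q e \<longleftrightarrow> sat (interleave e g') E' q"
    unfolding definable_def by blast
  show ?thesis
  proof (rule that)
    let ?p = "subst (\<lambda>n. Var (if even n then n else 2 * n - 1)) (\<lambda>X. 2 * X) p"
    let ?q = "subst (\<lambda>n. Var (if even n then n else Suc (2 * n))) (\<lambda>X. Suc (2 * X)) q"
    show "arithmetical ?p" "arithmetical ?q" using p q by simp_all
    show "\<forall>X. interleave E E' X \<in> sets" using p q by (intro interleave_in_sets)
    show "\<forall>e. P e \<longleftrightarrow> sat (interleave e (interleave g g')) (interleave E E') ?p"
      by (simp only: p(3) sat_subst interleave_left) simp
    show "\<forall>e. Q e \<longleftrightarrow> sat (interleave e (interleave g g')) (interleave E E') ?q"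
      by (simp only: q(3) sat_subst interleave_right) simp
  qed
qed

lemma dterm_common:
  assumes "dterm t" "dterm u"
  obtains t' u' g where "\<forall>e. t e = eval (interleave e g) t'" "\<forall>e. u e = eval (interleave e g) u'"
proof -
  from assms obtain t' g u' g' where
    t: "\<forall>e. t e = eval (interleave e g) t'" and u: "\<forall>e. u e = eval (interleave e g') u'"
    unfolding dterm_def by blast
  show ?thesis
  proof (rule that)
    let ?t = "subst_tm (\<lambda>n. Var (if even n then n else 2 * n - 1)) t'"
    let ?u = "subst_tm (\<lambda>n. Var (if even n then n else Suc (2 * n))) u'"
    show "\<forall>e. t e = eval (interleave e (interleave g g')) ?t"
      by (simp only: t eval_subst interleave_left) simp
    show "\<forall>e. u e = eval (interleave e (interleave g g')) ?u"
      by (simp only: u eval_subst interleave_right) simp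
  qed
qed

named_theorems definability

lemma dterm_var [definability]: "dterm (\<lambda>e. e n)"
  unfolding dterm_def by (intro exI[of _ "Var (2 * n)"]) (simp add: interleave_def)

lemma dterm_const [definability]: "dterm (\<lambda>e. a)"
  unfolding dterm_def by (intro exI[of _ "Var 1"] exI[of _ "\<lambda>_. a"]) (simp add: interleave_def)

lemma dterm_plus [definability]:
  assumes "dterm t" "dterm u" shows "dterm (\<lambda>e. t e \<uplus> u e)"
proof -
  obtain t' u' g where "\<forall>e. t e = eval (interleave e g) t'" "\<forall>e. u e = eval (interleave e g) u'"
    using dterm_common assms .
  then show ?thesis
    unfolding dterm_def by (intro exI[of _ "Plus t' u'"] exI[of _ g]) simp
qed

lemma dterm_times [definability]:
  assumes "dterm t" "dterm u" shows "dterm (\<lambda>e. t e \<odot> u e)"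
proof -
  obtain t' u' g where "\<forall>e. t e = eval (interleave e g) t'" "\<forall>e. u e = eval (interleave e g) u'"
    using dterm_common assms .
  then show ?thesis
    unfolding dterm_def by (intro exI[of _ "Times t' u'"] exI[of _ g]) simp
qed

lemma dterm_shift:
  assumes "dterm t" shows "dterm (\<lambda>e. t (\<lambda>n. e (Suc n)))"
proof -
  from assms obtain u g where u: "\<forall>e. t e = eval (interleave e g) u"
    unfolding dterm_def by blast
  have "(\<lambda>n. eval (interleave e g) (Var (if even n then n + 2 else n))) =
      interleave (\<lambda>n. e (Suc n)) g" for e
    by (auto simp: interleave_def)
  then show ?thesis
    unfolding dterm_def
    by (intro exI[of _ "subst_tm (\<lambda>n. Var (if even n then n + 2 else n)) u"] exI[of _ g])
      (simp only: u eval_subst, simp)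
qed

lemma definable_Eq [definability]:
  assumes "dterm t" "dterm u" shows "definable (\<lambda>e. t e = u e)"
proof -
  obtain t' u' g where "\<forall>e. t e = eval (interleave e g) t'" "\<forall>e. u e = eval (interleave e g) u'"
    using dterm_common assms .
  moreover obtain X where "X \<in> sets" using sets_nonempty by blast
  ultimately show ?thesis
    unfolding definable_def by (intro exI[of _ "Eq t' u'"] exI[of _ g] exI[of _ "\<lambda>_. X"]) simp
qed

lemma definable_Less [definability]:
  assumes "dterm t" "dterm u" shows "definable (\<lambda>e. t e \<prec> u e)"
proof -
  obtain t' u' g where "\<forall>e. t e = eval (interleave e g) t'" "\<forall>e. u e = eval (interleave e g) u'"
    using dterm_common assms .
  moreover obtain X where "X \<in> sets" using sets_nonempty by blast
  ultimately show ?thesis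
    unfolding definable_def by (intro exI[of _ "Less t' u'"] exI[of _ g] exI[of _ "\<lambda>_. X"]) simp
qed

lemma definable_Mem [definability]:
  assumes "dterm t" "X \<in> sets" shows "definable (\<lambda>e. t e \<in> X)"
proof -
  from assms obtain u g where "\<forall>e. t e = eval (interleave e g) u"
    unfolding dterm_def by blast
  then show ?thesis unfolding definable_def using assms(2)
    by (intro exI[of _ "u \<^bold>\<in> 0"] exI[of _ g] exI[of _ "\<lambda>_. X"]) simp
qed

lemma definable_Imp [definability]:
  assumes "definable P" "definable Q" shows "definable (\<lambda>e. P e \<longrightarrow> Q e)"
proof -
  obtain p q g E where "arithmetical p" "arithmetical q" "\<forall>X. E X \<in> sets"
    "\<forall>e. P e \<longleftrightarrow> sat (interleave e g) E p" "\<forall>e. Q e \<longleftrightarrow> sat (interleave e g) E q"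
    using definable_common assms .
  then show ?thesis
    unfolding definable_def by (intro exI[of _ "p \<^bold>\<longrightarrow> q"] exI[of _ g] exI[of _ E]) simp
qed

lemma definable_False: "definable (\<lambda>e. False)"
proof -
  obtain X where "X \<in> sets" using sets_nonempty by blast
  then show ?thesis
    unfolding definable_def by (intro exI[of _ Bot] exI[of _ "\<lambda>_. X"] exI[of _ "\<lambda>_. \<^bold>0"]) simp
qed

lemma definable_Not [definability]: "definable P \<Longrightarrow> definable (\<lambda>e. \<not> P e)"
  using definable_Imp[OF _ definable_False] by simp

lemma definable_Or [definability]: "definable P \<Longrightarrow> definable Q \<Longrightarrow> definable (\<lambda>e. P e \<or> Q e)"
  using definable_Imp[OF definable_Not, of P Q] by (simp add: imp_conv_disj)

lemma definable_And [definability]: "definable P \<Longrightarrow> definable Q \<Longrightarrow> definable (\<lambda>e. P e \<and> Q e)"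
  using definable_Not[OF definable_Imp[OF _ definable_Not, of P Q]] by simp

lemma definable_Iff [definability]: "definable P \<Longrightarrow> definable Q \<Longrightarrow> definable (\<lambda>e. P e \<longleftrightarrow> Q e)"
  unfolding iff_conv_conj_imp by (intro definable_And definable_Imp)

text \<open>The bound variable becomes argument 0 and the other arguments move up by one. With
  \<open>Q\<close> applied to both, the rule lets \<open>intro definability\<close> descend through
  quantifiers by unification.\<close>

lemma definable_All [definability]:
  assumes "definable (\<lambda>e. Q (e 0) (\<lambda>n. e (Suc n)))" shows "definable (\<lambda>e. \<forall>x. Q x e)"
proof -
  from assms obtain p g E where p: "arithmetical p" "\<forall>X. E X \<in> sets"
    "\<forall>e. Q (e 0) (\<lambda>n. e (Suc n)) \<longleftrightarrow> sat (interleave e g) E p"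
    unfolding definable_def by blast
  \<comment> \<open>Under the new binder every old position is raised by 1. Argument k + 1 of the
    body was argument k outside, at position 2k, so the even position n = 2k + 2 goes to 2k + 1 = n
    - 1; an odd position n keeps its parameter and goes to n + 1.\<close>
  let ?s = "\<lambda>n. Var (if n = 0 then 0 else if even n then n - 1 else Suc n)"
  have env: "(\<lambda>n. eval (case_nat a (interleave e g)) (?s n)) = interleave (case_nat a e) g" for a e
  proof
    fix n show "eval (case_nat a (interleave e g)) (?s n) = interleave (case_nat a e) g n"
    proof (cases "even n")
      case True
      then obtain k where "n = 2 * k" ..
      then show ?thesis by (cases k) (simp_all add: interleave_def)
    next
      case False
      then show ?thesis by (auto simp: interleave_def)
    qed
  qed
  have "Q a e \<longleftrightarrow> sat (interleave (case_nat a e) g) E p" for a e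
    using p(3)[rule_format, of "case_nat a e"] by simp
  then have "(\<forall>x. Q x e) \<longleftrightarrow> sat (interleave e g) E (AllN (subst ?s (\<lambda>X. X) p))" for e
    by (simp only: sat.simps sat_subst env)
  then show ?thesis unfolding definable_def using p(1,2)
    by (intro exI[of _ "AllN (subst ?s (\<lambda>X. X) p)"] exI[of _ g] exI[of _ E]) simp
qed

lemma definable_Ex [definability]:
  assumes "definable (\<lambda>e. Q (e 0) (\<lambda>n. e (Suc n)))" shows "definable (\<lambda>e. \<exists>x. Q x e)"
  using definable_Not[OF definable_All[of "\<lambda>x e. \<not> Q x e"], OF definable_Not[OF assms]] by simp

lemma definable_subst:
  assumes "definable (\<lambda>e. Q (e 0) (\<lambda>n. e (Suc n)))" "dterm t"
  shows "definable (\<lambda>e. Q (t e) e)"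
proof -
  have "definable (\<lambda>e. \<forall>x. x = t e \<longrightarrow> Q x e)"
    by (intro definability dterm_shift assms)
  then show ?thesis by simp
qed

text \<open>A defined predicate is unfolded once, at variables, and its definability then carries
  over to arbitrary terms.\<close>

lemma definable1:
  "definable (\<lambda>e. P (e 0)) \<Longrightarrow> dterm t \<Longrightarrow> definable (\<lambda>e. P (t e))"
  using definable_subst[of "\<lambda>x e. P x" t] by simp

lemma definable2:
  assumes "definable (\<lambda>e. P (e 0) (e (Suc 0)))" "dterm t" "dterm u"
  shows "definable (\<lambda>e. P (t e) (u e))"
proof (rule definable_subst[of "\<lambda>y e. P (t e) y", OF _ assms(3)])
  show "definable (\<lambda>e. P (t (\<lambda>n. e (Suc n))) (e 0))"
    by (rule definable_subst[of "\<lambda>x e. P x (e 0)"]) (intro assms(1) dterm_shift assms)+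
qed

section \<open>Comprehension, induction and the semiring of numbers\<close>

lemma sat_axiom: "q \<in> ACA0 \<Longrightarrow> (\<And>X. E X \<in> sets) \<Longrightarrow> sat e E q"
  using models_ACA0 unfolding models_def by simp

lemma comprehension:
  assumes "definable (\<lambda>e. P (e 0))" shows "{x. P x} \<in> sets"
proof -
  from assms obtain p g E where p: "arithmetical p" "\<forall>X. E X \<in> sets"
    "\<forall>e. P (e 0) \<longleftrightarrow> sat (interleave e g) E p"
    unfolding definable_def by blast
  \<comment> \<open>The axiom abstracts number variable 0 only, so all argument positions are filled
    with it; \<open>P\<close> is then evaluated at a constant environment. Parameter k moves to
    variable k + 1.\<close>
  let ?p = "subst (\<lambda>n. Var (if even n then 0 else Suc (n div 2))) (\<lambda>X. X) p"
  have "sat g E (Defs.comprehension ?p)"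
    using p(1,2) by (intro sat_axiom) (auto simp: ACA0_def)
  then obtain A where A: "A \<in> sets" "\<forall>x. x \<in> A \<longleftrightarrow> sat (case_nat x g) E ?p"
    by (auto simp: Defs.comprehension_def sat_subst)
  have "(\<lambda>n. eval (case_nat x g) (Var (if even n then 0 else Suc (n div 2)))) =
      interleave (\<lambda>_. x) g" for x
    by (auto simp: interleave_def)
  then have "\<forall>x. x \<in> A \<longleftrightarrow> P x"
    using A(2) p(3)[rule_format, of "\<lambda>_. _"] unfolding sat_subst by simp
  then have "A = {x. P x}" by blast
  with A(1) show ?thesis by simp
qed

text \<open>In a nonstandard model this is the available form of induction, which is why the
  inductions inside the model below begin by proving their predicate definable.\<close>

lemma induct [case_names zero succ]:
  assumes "definable (\<lambda>e. P (e 0))" "P \<^bold>0" "\<And>n. P n \<Longrightarrow> P (n \<uplus> \<^bold>1)"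
  shows "P n"
proof -
  obtain X where "X \<in> sets" using sets_nonempty by blast
  then have ax: "sat (\<lambda>_. \<^bold>0) (\<lambda>_. X) induction_axiom"
    by (intro sat_axiom) (simp_all add: ACA0_def)
  have "sat (\<lambda>_. \<^bold>0) (\<lambda>_. X) induction_axiom \<longleftrightarrow>
      (\<forall>A\<in>sets. \<^bold>0 \<in> A \<and> (\<forall>n. n \<in> A \<longrightarrow> n \<uplus> \<^bold>1 \<in> A) \<longrightarrow> (\<forall>n. n \<in> A))"
    by (simp add: induction_axiom_def)
  from this[THEN iffD1, OF ax, rule_format, OF comprehension[OF assms(1)], of n] show ?thesis
    using assms(2,3) by simp
qed

lemma basic:
  "n \<uplus> \<^bold>1 \<noteq> \<^bold>0" "m \<uplus> \<^bold>1 = n \<uplus> \<^bold>1 \<Longrightarrow> m = n" "m \<uplus> \<^bold>0 = m" "m \<uplus> (n \<uplus> \<^bold>1) = m \<uplus> n \<uplus> \<^bold>1"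
  "m \<odot> \<^bold>0 = \<^bold>0" "m \<odot> (n \<uplus> \<^bold>1) = m \<odot> n \<uplus> m" "\<not> m \<prec> \<^bold>0" "m \<prec> n \<uplus> \<^bold>1 \<longleftrightarrow> m \<prec> n \<or> m = n"
proof -
  obtain X where "X \<in> sets" using sets_nonempty by blast
  then have "sat (case_nat m (\<lambda>_. n)) (\<lambda>_. X) p" if "p \<in> basic_axioms" for p
    using that by (intro sat_axiom) (simp_all add: ACA0_def)
  then have "\<forall>p\<in>basic_axioms. sat (case_nat m (\<lambda>_. n)) (\<lambda>_. X) p" by blast
  note ax = this[unfolded basic_axioms_def Let_def, simplified]
  from ax show "n \<uplus> \<^bold>1 \<noteq> \<^bold>0" "m \<uplus> \<^bold>1 = n \<uplus> \<^bold>1 \<Longrightarrow> m = n" "m \<uplus> \<^bold>0 = m" "m \<uplus> (n \<uplus> \<^bold>1) = m \<uplus> n \<uplus> \<^bold>1"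
    "m \<odot> \<^bold>0 = \<^bold>0" "m \<odot> (n \<uplus> \<^bold>1) = m \<odot> n \<uplus> m" "\<not> m \<prec> \<^bold>0" "m \<prec> n \<uplus> \<^bold>1 \<longleftrightarrow> m \<prec> n \<or> m = n"
    by blast+
qed

lemma add_assoc: "a \<uplus> b \<uplus> c = a \<uplus> (b \<uplus> c)"
  by (rule induct[where n = c], intro definability) (simp_all add: basic(3-6))

lemma add_zero_left: "\<^bold>0 \<uplus> a = a"
  by (rule induct[where n = a], intro definability) (simp_all add: basic(3-6))

lemma add_one_left: "\<^bold>1 \<uplus> a = a \<uplus> \<^bold>1"
  by (rule induct[where n = a], intro definability) (simp_all add: basic(3-6) add_zero_left)

lemma add_comm: "a \<uplus> b = b \<uplus> a"
proof (rule induct[where n = b], intro definability)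
  show "a \<uplus> (n \<uplus> \<^bold>1) = n \<uplus> \<^bold>1 \<uplus> a" if "a \<uplus> n = n \<uplus> a" for n
    using that by (simp add: add_assoc[symmetric]) (simp add: add_assoc add_one_left)
qed (simp add: basic(3-6) add_zero_left)

lemma add_left_commute: "a \<uplus> (b \<uplus> c) = b \<uplus> (a \<uplus> c)"
  by (metis add_assoc add_comm)

lemma mult_add: "a \<odot> (b \<uplus> c) = a \<odot> b \<uplus> a \<odot> c"
proof (rule induct[where n = c], intro definability)
  show "a \<odot> (b \<uplus> (n \<uplus> \<^bold>1)) = a \<odot> b \<uplus> a \<odot> (n \<uplus> \<^bold>1)"
    if "a \<odot> (b \<uplus> n) = a \<odot> b \<uplus> a \<odot> n" for n
    using that by (simp only: basic(6) add_assoc[symmetric])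
qed (simp add: basic(3-6))

lemma mult_assoc: "a \<odot> b \<odot> c = a \<odot> (b \<odot> c)"
proof (rule induct[where n = c], intro definability)
  show "a \<odot> b \<odot> (n \<uplus> \<^bold>1) = a \<odot> (b \<odot> (n \<uplus> \<^bold>1))" if "a \<odot> b \<odot> n = a \<odot> (b \<odot> n)" for n
    using that by (simp only: basic(6)) (simp only: mult_add)
qed (simp add: basic(5))

lemma mult_zero_left: "\<^bold>0 \<odot> a = \<^bold>0"
  by (rule induct[where n = a], intro definability) (simp_all add: basic(3-6))

lemma mult_one_left: "\<^bold>1 \<odot> a = a"
  by (rule induct[where n = a], intro definability) (simp_all add: basic(3-6))

lemma mult_succ_left: "(a \<uplus> \<^bold>1) \<odot> b = a \<odot> b \<uplus> b"
proof (rule induct[where n = b], intro definability)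
  show "(a \<uplus> \<^bold>1) \<odot> (n \<uplus> \<^bold>1) = a \<odot> (n \<uplus> \<^bold>1) \<uplus> (n \<uplus> \<^bold>1)"
    if "(a \<uplus> \<^bold>1) \<odot> n = a \<odot> n \<uplus> n" for n
    by (simp only: basic(6) that add_assoc add_left_commute[of n a])
qed (simp add: basic(3-6))

lemma mult_comm: "a \<odot> b = b \<odot> a"
proof (rule induct[where n = b], intro definability)
  show "a \<odot> (n \<uplus> \<^bold>1) = (n \<uplus> \<^bold>1) \<odot> a" if "a \<odot> n = n \<odot> a" for n
    by (simp only: basic(6) that mult_succ_left)
qed (simp add: basic(3-6) mult_zero_left)

text \<open>Opens the simplification rules for semirings, by which the polynomial identities below
  are checked.\<close>

sublocale M: comm_semiring_1 where one = "\<^bold>1" and times = "(\<odot>)" and plus = "(\<uplus>)" and zero = "\<^bold>0"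
proof
  show "\<^bold>0 \<noteq> \<^bold>1" using basic(1)[of "\<^bold>0"] add_zero_left[of "\<^bold>1"] by metis
  show "(a \<uplus> b) \<odot> c = a \<odot> c \<uplus> b \<odot> c" for a b c
    by (simp only: mult_comm[of _ c] mult_add)
qed (rule add_assoc add_comm add_zero_left mult_assoc mult_comm mult_zero_left mult_one_left basic(5))+

end

section \<open>Arithmetic in the model\<close>

context aca_model
begin

lemma zero_or_succ: "a = \<^bold>0 \<or> (\<exists>b. a = b \<uplus> \<^bold>1)"
  by (rule induct[where n = a], intro definability) auto

lemma add_cancel_right: "a \<uplus> c = b \<uplus> c \<longleftrightarrow> a = b"
proof
  have "a \<uplus> c = b \<uplus> c \<longrightarrow> a = b"
    by (rule induct[where n = c], intro definability) (auto simp: add_assoc[symmetric] dest: basic(2))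
  then show "a \<uplus> c = b \<uplus> c \<Longrightarrow> a = b" ..
qed simp

lemma add_cancel_left: "c \<uplus> a = c \<uplus> b \<longleftrightarrow> a = b"
  using add_cancel_right add_comm by metis

lemma add_eq_zero: "a \<uplus> b = \<^bold>0 \<longleftrightarrow> a = \<^bold>0 \<and> b = \<^bold>0"
  using zero_or_succ[of b] basic(1) by (metis M.add_0_right add_assoc)

lemma mult_eq_zero: "a \<odot> b = \<^bold>0 \<longleftrightarrow> a = \<^bold>0 \<or> b = \<^bold>0"
  using zero_or_succ[of b] by (metis M.mult_zero_left add_eq_zero basic(5,6))

text \<open>The axioms give the order only by recursion on the right argument; this description
  turns order facts into semiring identities.\<close>

lemma less_iff: "a \<prec> b \<longleftrightarrow> (\<exists>c. b = a \<uplus> c \<uplus> \<^bold>1)"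
proof (rule induct[where n = b])
  show "definable (\<lambda>e. a \<prec> e 0 \<longleftrightarrow> (\<exists>c. e 0 = a \<uplus> c \<uplus> \<^bold>1))"
    by (intro definability)
  show "a \<prec> \<^bold>0 \<longleftrightarrow> (\<exists>c. \<^bold>0 = a \<uplus> c \<uplus> \<^bold>1)"
    using basic(7) basic(1) by metis
  fix b assume IH: "a \<prec> b \<longleftrightarrow> (\<exists>c. b = a \<uplus> c \<uplus> \<^bold>1)"
  have "a \<prec> b \<uplus> \<^bold>1 \<longleftrightarrow> (\<exists>c. b = a \<uplus> (c \<uplus> \<^bold>1)) \<or> b = a \<uplus> \<^bold>0"
    unfolding basic(8) IH by (auto simp: add_assoc)
  also have "\<dots> \<longleftrightarrow> (\<exists>c. b = a \<uplus> c)"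
    using zero_or_succ by metis
  also have "\<dots> \<longleftrightarrow> (\<exists>c. b \<uplus> \<^bold>1 = a \<uplus> c \<uplus> \<^bold>1)"
    by (simp add: add_cancel_right)
  finally show "a \<prec> b \<uplus> \<^bold>1 \<longleftrightarrow> (\<exists>c. b \<uplus> \<^bold>1 = a \<uplus> c \<uplus> \<^bold>1)" .
qed

definition le :: "'a \<Rightarrow> 'a \<Rightarrow> bool"  (infix \<open>\<preceq>\<close> 50)
  where "a \<preceq> b \<longleftrightarrow> a \<prec> b \<or> a = b"

lemma definable_le [definability]: "dterm t \<Longrightarrow> dterm u \<Longrightarrow> definable (\<lambda>e. t e \<preceq> u e)"
  unfolding le_def by (intro definability)

lemma less_succ: "a \<prec> b \<uplus> \<^bold>1 \<longleftrightarrow> a \<preceq> b"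
  unfolding le_def basic(8) ..

lemma le_iff: "a \<preceq> b \<longleftrightarrow> (\<exists>c. b = a \<uplus> c)"
  unfolding less_succ[symmetric] less_iff by (simp add: add_cancel_right)

lemma less_irrefl: "\<not> a \<prec> a"
  unfolding less_iff using add_cancel_left[of a _ "\<^bold>0"] basic(1) by (metis M.add_0_right add_assoc)

lemma less_trans: "a \<prec> b \<Longrightarrow> b \<prec> c \<Longrightarrow> a \<prec> c"
  unfolding less_iff by (auto simp: add_assoc) (metis add_assoc)

sublocale O: linorder "(\<preceq>)" "(\<prec>)"
proof
  fix a b c
  show "a \<prec> b \<longleftrightarrow> a \<preceq> b \<and> \<not> b \<preceq> a" "a \<preceq> b \<Longrightarrow> b \<preceq> a \<Longrightarrow> a = b"
    "a \<preceq> a" "a \<preceq> b \<Longrightarrow> b \<preceq> c \<Longrightarrow> a \<preceq> c"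
    unfolding le_def using less_irrefl less_trans by blast+
  have zero: "\<^bold>0 \<preceq> x" for x
    unfolding le_iff by simp
  have "a \<preceq> b \<or> b \<prec> a"
  proof (rule induct[where n = b], intro definability)
    show "a \<preceq> \<^bold>0 \<or> \<^bold>0 \<prec> a" using zero[of a] by (auto simp: le_def)
    fix n assume "a \<preceq> n \<or> n \<prec> a"
    then show "a \<preceq> n \<uplus> \<^bold>1 \<or> n \<uplus> \<^bold>1 \<prec> a"
    proof
      assume "a \<preceq> n" then show ?thesis unfolding le_def basic(8) by blast
    next
      assume "n \<prec> a"
      then obtain c where "a = (n \<uplus> \<^bold>1) \<uplus> c"
        unfolding less_iff by (metis add_assoc add_comm)
      then have "n \<uplus> \<^bold>1 \<preceq> a" unfolding le_iff by blast
      then show ?thesis unfolding le_def by blast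
    qed
  qed
  then show "a \<preceq> b \<or> b \<preceq> a" unfolding le_def by blast
qed

lemma zero_le: "\<^bold>0 \<preceq> a"
  unfolding le_iff by simp

lemma zero_less: "\<^bold>0 \<prec> a \<longleftrightarrow> a \<noteq> \<^bold>0"
  using zero_le[of a] unfolding le_def using less_irrefl by blast

lemma least:
  assumes "definable (\<lambda>e. P (e 0))" "P n"
  shows "\<exists>m. P m \<and> (\<forall>k. k \<prec> m \<longrightarrow> \<not> P k)"
proof (rule ccontr)
  assume none: "\<not> ?thesis"
  have "\<forall>k. k \<prec> n \<longrightarrow> \<not> P k" for n
  proof (rule induct[where n = n])
    show "definable (\<lambda>e. \<forall>k. k \<prec> e 0 \<longrightarrow> \<not> P k)"
      by (intro definability definable1[OF assms(1)])
  qed (use basic(7) basic(8) none in blast)+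
  then show False using none assms(2) by blast
qed

section \<open>Pairing and divisibility of numbers\<close>

definition pair :: "'a \<Rightarrow> 'a \<Rightarrow> 'a"
  where "pair i j = (i \<uplus> j) \<odot> (i \<uplus> j) \<uplus> i"

lemma dterm_pair [definability]: "dterm t \<Longrightarrow> dterm u \<Longrightarrow> dterm (\<lambda>e. pair (t e) (u e))"
  unfolding pair_def by (intro definability)

lemma eval_pair_tm [simp]: "eval e (pair_tm t u) = pair (eval e t) (eval e u)"
  by (simp add: pair_tm_def pair_def)

text \<open>With s = i + j, the squares of s and s + 1 differ by 2s + 1, which exceeds i. So pairs
  with different sums have different codes.\<close>

lemma pair_less:
  assumes "i \<uplus> j \<prec> i' \<uplus> j'" shows "pair i j \<prec> pair i' j'"
proof -
  obtain c where c: "i' \<uplus> j' = i \<uplus> j \<uplus> c \<uplus> \<^bold>1"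
    using assms unfolding less_iff by blast
  let ?s = "i \<uplus> j"
  \<comment> \<open>The part \<open>j \<uplus> ?s\<close> is 2s - i, written without
    subtraction.\<close>
  have "pair i' j' = pair i j \<uplus> (j \<uplus> ?s \<uplus> ?s \<odot> c \<uplus> ?s \<odot> c \<uplus> c \<odot> c \<uplus> c \<uplus> c \<uplus> i') \<uplus> \<^bold>1"
    unfolding pair_def c by (simp add: algebra_simps)
  then show ?thesis unfolding less_iff by blast
qed

lemma pair_inject [simp]: "pair i j = pair i' j' \<longleftrightarrow> i = i' \<and> j = j'"
proof
  assume eq: "pair i j = pair i' j'"
  then have "i \<uplus> j = i' \<uplus> j'"
    using pair_less less_irrefl O.less_linear by metis
  with eq show "i = i' \<and> j = j'"
    unfolding pair_def by (auto simp: add_cancel_left)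
qed simp

definition mdvd :: "'a \<Rightarrow> 'a \<Rightarrow> bool"
  where "mdvd a b \<longleftrightarrow> (\<exists>k. b = a \<odot> k)"

lemma definable_mdvd [definability]: "dterm t \<Longrightarrow> dterm u \<Longrightarrow> definable (\<lambda>e. mdvd (t e) (u e))"
  by (rule definable2[of mdvd]; assumption?) (unfold mdvd_def, intro definability)

text \<open>The quotient is x - y if that exists; if x is at most y, the equation forces e to be
  0.\<close>

lemma mdvd_add_cancel:
  assumes "mdvd a (e \<uplus> a \<odot> y)" shows "mdvd a e"
proof -
  obtain x where x: "e \<uplus> a \<odot> y = a \<odot> x"
    using assms unfolding mdvd_def by blast
  from O.linear[of x y] consider z where "x = y \<uplus> z" | z where "y = x \<uplus> z"
    unfolding le_iff by blast
  then show ?thesis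
  proof cases
    case 1
    then have "e \<uplus> a \<odot> y = a \<odot> z \<uplus> a \<odot> y" using x by (simp add: mult_add add_comm)
    then show ?thesis unfolding add_cancel_right mdvd_def by blast
  next
    case 2
    then have "(e \<uplus> a \<odot> z) \<uplus> a \<odot> x = \<^bold>0 \<uplus> a \<odot> x"
      using x by (simp add: mult_add ac_simps)
    then have "e = a \<odot> \<^bold>0" unfolding add_cancel_right add_eq_zero by simp
    then show ?thesis unfolding mdvd_def by blast
  qed
qed

text \<open>If \<open>i - j\<close> divides \<open>m\<close>, then \<open>1 + i m\<close> and \<open>1 + j m\<close> are coprime; the Bezout coefficients
  are written out, with both sides moved so that no subtraction occurs.\<close>

lemma mdvd_cancel_coprime:
  assumes m: "\<And>s. i = j \<uplus> s \<or> j = i \<uplus> s \<Longrightarrow> mdvd s m"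
    and dvd: "mdvd (\<^bold>1 \<uplus> i \<odot> m) ((\<^bold>1 \<uplus> j \<odot> m) \<odot> e)"
  shows "mdvd (\<^bold>1 \<uplus> i \<odot> m) e"
proof -
  let ?a = "\<^bold>1 \<uplus> i \<odot> m" and ?q = "\<^bold>1 \<uplus> j \<odot> m"
  obtain k where k: "?q \<odot> e = ?a \<odot> k"
    using dvd unfolding mdvd_def by blast
  from O.linear[of i j] consider s where "j = i \<uplus> s" | s where "i = j \<uplus> s"
    unfolding le_iff by blast
  then show ?thesis
  proof cases
    case 1
    then obtain t where t: "m = s \<odot> t" using m unfolding mdvd_def by blast
    \<comment> \<open>Here j a - i q = j - i = s and i m = a - 1. Substituting m = s t gives 1 = a -
      i t s = a (1 - i j t) + i i t q, which is multiplied by e.\<close>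
    have "e \<uplus> ?a \<odot> (i \<odot> t \<odot> j \<odot> e) = i \<odot> i \<odot> t \<odot> (?q \<odot> e) \<uplus> ?a \<odot> e"
      unfolding t 1 by (simp add: algebra_simps)
    also have "\<dots> = ?a \<odot> (i \<odot> i \<odot> t \<odot> k \<uplus> e)"
      unfolding k by (simp add: algebra_simps)
    finally have "mdvd ?a (e \<uplus> ?a \<odot> (i \<odot> t \<odot> j \<odot> e))"
      unfolding mdvd_def by blast
    then show ?thesis by (rule mdvd_add_cancel)
  next
    case 2
    then obtain t where t: "m = s \<odot> t" using m unfolding mdvd_def by blast
    \<comment> \<open>Now s = i q - j a, so the signs change: 1 = a (1 + i j t) - i i t q.\<close>
    have "e \<uplus> ?a \<odot> (i \<odot> i \<odot> t \<odot> k) = e \<uplus> i \<odot> i \<odot> t \<odot> (?q \<odot> e)"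
      unfolding k by (simp add: algebra_simps)
    also have "\<dots> = ?a \<odot> (e \<uplus> i \<odot> t \<odot> j \<odot> e)"
      unfolding t 2 by (simp add: algebra_simps)
    finally have "mdvd ?a (e \<uplus> ?a \<odot> (i \<odot> i \<odot> t \<odot> k))"
      unfolding mdvd_def by blast
    then show ?thesis by (rule mdvd_add_cancel)
  qed
qed

text \<open>Multiplying the current v by the next nonzero value plays the part of a factorial or
  finite product. The hypothesis on \<open>f\<close> keeps the induction predicate definable. With
  the identity for \<open>f\<close> the lemma yields m, with the moduli it yields v.\<close>

lemma common_multiple:
  assumes "\<And>t. dterm t \<Longrightarrow> dterm (\<lambda>e. f (t e))"
  shows "\<exists>v. v \<noteq> \<^bold>0 \<and> (\<forall>i. i \<preceq> N \<and> f i \<noteq> \<^bold>0 \<longrightarrow> mdvd (f i) v)"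
proof -
  have step: "\<exists>v'. v' \<noteq> \<^bold>0 \<and> mdvd v v' \<and> (f n \<noteq> \<^bold>0 \<longrightarrow> mdvd (f n) v')" if "v \<noteq> \<^bold>0" for v n
  proof (cases "f n = \<^bold>0")
    case False
    then have "v \<odot> f n \<noteq> \<^bold>0" "mdvd v (v \<odot> f n)" "mdvd (f n) (v \<odot> f n)"
      using that unfolding mdvd_def by (auto simp: mult_eq_zero mult_comm)
    then show ?thesis by blast
  next
    case True
    moreover have "mdvd v v" unfolding mdvd_def by (rule exI[of _ "\<^bold>1"]) simp
    ultimately show ?thesis using that by blast
  qed
  have trans: "mdvd x y \<Longrightarrow> mdvd y z \<Longrightarrow> mdvd x z" for x y z
    unfolding mdvd_def by (auto simp: mult_assoc)
  show ?thesis
  proof (rule induct[where n = N])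
    show "definable (\<lambda>e. \<exists>v. v \<noteq> \<^bold>0 \<and> (\<forall>i. i \<preceq> e 0 \<and> f i \<noteq> \<^bold>0 \<longrightarrow> mdvd (f i) v))"
      by (intro definability assms)
    have "i \<preceq> \<^bold>0 \<longleftrightarrow> i = \<^bold>0" for i
      unfolding le_def using basic(7) by blast
    then show "\<exists>v. v \<noteq> \<^bold>0 \<and> (\<forall>i. i \<preceq> \<^bold>0 \<and> f i \<noteq> \<^bold>0 \<longrightarrow> mdvd (f i) v)"
      using step[of "\<^bold>1" "\<^bold>0"] by auto
  next
    fix n assume "\<exists>v. v \<noteq> \<^bold>0 \<and> (\<forall>i. i \<preceq> n \<and> f i \<noteq> \<^bold>0 \<longrightarrow> mdvd (f i) v)"
    then obtain v where v: "v \<noteq> \<^bold>0" "\<forall>i. i \<preceq> n \<and> f i \<noteq> \<^bold>0 \<longrightarrow> mdvd (f i) v" by blast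
    obtain v' where v': "v' \<noteq> \<^bold>0" "mdvd v v'" "f (n \<uplus> \<^bold>1) \<noteq> \<^bold>0 \<longrightarrow> mdvd (f (n \<uplus> \<^bold>1)) v'"
      using step[OF v(1)] by blast
    have "i \<preceq> n \<uplus> \<^bold>1 \<longleftrightarrow> i \<preceq> n \<or> i = n \<uplus> \<^bold>1" for i
      unfolding le_def basic(8) by blast
    then show "\<exists>v. v \<noteq> \<^bold>0 \<and> (\<forall>i. i \<preceq> n \<uplus> \<^bold>1 \<and> f i \<noteq> \<^bold>0 \<longrightarrow> mdvd (f i) v)"
      using v v' trans by (intro exI[of _ v']) metis
  qed
qed

lemma less_mult:
  assumes "k \<noteq> \<^bold>0" "v \<noteq> \<^bold>0" shows "v \<prec> (\<^bold>1 \<uplus> k) \<odot> v"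
proof -
  have "k \<odot> v \<noteq> \<^bold>0" using assms by (simp add: mult_eq_zero)
  then obtain c where "k \<odot> v = c \<uplus> \<^bold>1" using zero_or_succ by blast
  then have "(\<^bold>1 \<uplus> k) \<odot> v = v \<uplus> c \<uplus> \<^bold>1" by (simp add: M.distrib_right add_assoc)
  then show ?thesis unfolding less_iff by blast
qed

end

section \<open>Divisibility in the ring\<close>

text \<open>Principality is assumed for nonempty sets of the model, which suits ideals given by
  comprehension; \<open>sat_is_sigma1_PID\<close> derives it from the statement about sequences. The
  ring operations act on numbers of the model and are unrelated to \<open>\<uplus>\<close> and
  \<open>\<odot>\<close>.\<close>

locale sigma1_PID = aca_model zr on pl ti ls sets + cring R
  for zr :: 'a  (\<open>\<^bold>0\<close>) and on :: 'a  (\<open>\<^bold>1\<close>)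
    and pl :: "'a \<Rightarrow> 'a \<Rightarrow> 'a"  (infixl \<open>\<uplus>\<close> 65)
    and ti :: "'a \<Rightarrow> 'a \<Rightarrow> 'a"  (infixl \<open>\<odot>\<close> 70)
    and ls :: "'a \<Rightarrow> 'a \<Rightarrow> bool"  (infix \<open>\<prec>\<close> 50)
    and sets :: "'a set set"
    and R :: "('a, 'b) ring_scheme"  (structure) +
  assumes carrier_set: "carrier R \<in> sets"
    and add_set: "{pair (pair a b) (a \<oplus> b) |a b. a \<in> carrier R \<and> b \<in> carrier R} \<in> sets"
    and mult_set: "{pair (pair a b) (a \<otimes> b) |a b. a \<in> carrier R \<and> b \<in> carrier R} \<in> sets"
    and integral: "a \<in> carrier R \<Longrightarrow> b \<in> carrier R \<Longrightarrow> a \<otimes> b = \<zero> \<Longrightarrow> a = \<zero> \<or> b = \<zero>"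
    and principal: "I \<in> sets \<Longrightarrow> I \<subseteq> carrier R \<Longrightarrow> I \<noteq> {} \<Longrightarrow>
      (\<And>a b r s. a \<in> I \<Longrightarrow> b \<in> I \<Longrightarrow> r \<in> carrier R \<Longrightarrow> s \<in> carrier R \<Longrightarrow> a \<otimes> r \<oplus> b \<otimes> s \<in> I) \<Longrightarrow>
      \<exists>c\<in>carrier R. \<forall>x. x \<in> I \<longleftrightarrow> (\<exists>r\<in>carrier R. x = c \<otimes> r)"
begin

text \<open>Ring operations are not terms: only their graphs are sets of the model, and these say
  nothing outside the carrier. The membership conditions therefore travel with each equation, and
  \<open>rdvd\<close> is shaped accordingly.\<close>

lemma definable_sum [definability]:
  assumes "dterm t" "dterm u" "dterm v"
  shows "definable (\<lambda>e. t e \<in> carrier R \<and> u e \<in> carrier R \<and> v e = t e \<oplus> u e)"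
proof -
  have "definable (\<lambda>e. pair (pair (t e) (u e)) (v e) \<in> {pair (pair a b) (a \<oplus> b) |a b. a \<in> carrier R \<and> b \<in> carrier R})"
    by (intro definability assms add_set)
  then show ?thesis by (simp add: conj_commute conj_left_commute)
qed

lemma definable_prod [definability]:
  assumes "dterm t" "dterm u" "dterm v"
  shows "definable (\<lambda>e. t e \<in> carrier R \<and> u e \<in> carrier R \<and> v e = t e \<otimes> u e)"
proof -
  have "definable (\<lambda>e. pair (pair (t e) (u e)) (v e) \<in> {pair (pair a b) (a \<otimes> b) |a b. a \<in> carrier R \<and> b \<in> carrier R})"
    by (intro definability assms mult_set)
  then show ?thesis by (simp add: conj_commute conj_left_commute)
qed

definition rdvd :: "'a \<Rightarrow> 'a \<Rightarrow> bool"
  where "rdvd a b \<longleftrightarrow> (\<exists>r. a \<in> carrier R \<and> r \<in> carrier R \<and> b = a \<otimes> r)"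

lemma definable_rdvd [definability]:
  assumes "dterm t" "dterm u" shows "definable (\<lambda>e. rdvd (t e) (u e))"
proof (rule definable2[of rdvd, OF _ assms])
  show "definable (\<lambda>e. rdvd (e 0) (e (Suc 0)))"
    unfolding rdvd_def by (rule definable_Ex, rule definable_prod) (intro definability)+
qed

lemma rdvd_carrier: "rdvd a b \<Longrightarrow> a \<in> carrier R" "rdvd a b \<Longrightarrow> b \<in> carrier R"
  unfolding rdvd_def by auto

lemma rdvd_refl: "a \<in> carrier R \<Longrightarrow> rdvd a a"
  unfolding rdvd_def by (intro exI[of _ \<one>]) simp

lemma rdvd_mult: "a \<in> carrier R \<Longrightarrow> r \<in> carrier R \<Longrightarrow> rdvd a (a \<otimes> r)"
  unfolding rdvd_def by blast

lemma rdvd_trans: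
  assumes "rdvd a b" "rdvd b c" shows "rdvd a c"
proof -
  obtain r s where r: "a \<in> carrier R" "r \<in> carrier R" "b = a \<otimes> r" "s \<in> carrier R" "c = b \<otimes> s"
    using assms unfolding rdvd_def by blast
  then have "c = a \<otimes> (r \<otimes> s)" by (simp add: m_assoc)
  then show ?thesis using r rdvd_mult by auto
qed

lemma rdvd_comb:
  assumes "rdvd c a" "rdvd c b" "r \<in> carrier R" "s \<in> carrier R"
  shows "rdvd c (a \<otimes> r \<oplus> b \<otimes> s)"
proof -
  obtain k l where k: "c \<in> carrier R" "k \<in> carrier R" "a = c \<otimes> k" "l \<in> carrier R" "b = c \<otimes> l"
    using assms unfolding rdvd_def by blast
  then have "a \<otimes> r \<oplus> b \<otimes> s = c \<otimes> (k \<otimes> r \<oplus> l \<otimes> s)"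
    using assms by (simp add: m_assoc r_distr)
  then show ?thesis using k assms rdvd_mult by auto
qed

lemma cancel_left:
  assumes "a \<in> carrier R" "b \<in> carrier R" "c \<in> carrier R" "a \<noteq> \<zero>" "a \<otimes> b = a \<otimes> c"
  shows "b = c"
proof -
  have "a \<otimes> (b \<ominus> c) = a \<otimes> b \<ominus> a \<otimes> c" using assms by algebra
  also have "\<dots> = \<zero>" using assms by (simp add: minus_eq r_neg)
  finally have "b \<ominus> c = \<zero>" using integral[of a "b \<ominus> c"] assms by simp
  moreover have "b = (b \<ominus> c) \<oplus> c" using assms by algebra
  ultimately show ?thesis using assms by simp
qed

lemma bezout:
  assumes "a \<in> carrier R" "b \<in> carrier R"
  shows "\<exists>x\<in>carrier R. \<exists>y\<in>carrier R. rdvd (a \<otimes> x \<oplus> b \<otimes> y) a \<and> rdvd (a \<otimes> x \<oplus> b \<otimes> y) b"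
proof -
  \<comment> \<open>The ideal (a, b); the intermediate results are named so that
    \<open>definable_prod\<close> and \<open>definable_sum\<close> apply.\<close>
  define I where "I = {w. \<exists>x y u v. (a \<in> carrier R \<and> x \<in> carrier R \<and> u = a \<otimes> x) \<and>
    (b \<in> carrier R \<and> y \<in> carrier R \<and> v = b \<otimes> y) \<and> (u \<in> carrier R \<and> v \<in> carrier R \<and> w = u \<oplus> v)}"
  have I: "w \<in> I \<longleftrightarrow> (\<exists>x\<in>carrier R. \<exists>y\<in>carrier R. w = a \<otimes> x \<oplus> b \<otimes> y)" for w
    unfolding I_def using assms by auto
  have "\<exists>c\<in>carrier R. \<forall>x. x \<in> I \<longleftrightarrow> (\<exists>r\<in>carrier R. x = c \<otimes> r)"
  proof (rule principal)
    show "I \<in> sets" unfolding I_def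
      by (rule comprehension) (intro definable_Ex definable_And[OF definable_prod definable_And[OF definable_prod definable_sum]] dterm_var dterm_const)
    show "I \<subseteq> carrier R" using I assms by auto
    show "I \<noteq> {}" using I assms by blast
    fix c d r s assume cd: "c \<in> I" "d \<in> I" and rs: "r \<in> carrier R" "s \<in> carrier R"
    from cd obtain x y x' y' where *: "x \<in> carrier R" "y \<in> carrier R" "c = a \<otimes> x \<oplus> b \<otimes> y"
      "x' \<in> carrier R" "y' \<in> carrier R" "d = a \<otimes> x' \<oplus> b \<otimes> y'" unfolding I by blast
    then have "c \<otimes> r \<oplus> d \<otimes> s = a \<otimes> (x \<otimes> r \<oplus> x' \<otimes> s) \<oplus> b \<otimes> (y \<otimes> r \<oplus> y' \<otimes> s)"
      using assms rs by algebra
    moreover have "x \<otimes> r \<oplus> x' \<otimes> s \<in> carrier R" "y \<otimes> r \<oplus> y' \<otimes> s \<in> carrier R"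
      using * rs by simp_all
    ultimately show "c \<otimes> r \<oplus> d \<otimes> s \<in> I" unfolding I by blast
  qed
  then obtain c where c: "c \<in> carrier R" "\<And>x. x \<in> I \<longleftrightarrow> (\<exists>r\<in>carrier R. x = c \<otimes> r)" by blast
  have "c \<in> I" using c(1) unfolding c(2) by (metis one_closed r_one)
  moreover have "a = a \<otimes> \<one> \<oplus> b \<otimes> \<zero>" "b = a \<otimes> \<zero> \<oplus> b \<otimes> \<one>" using assms by simp_all
  then have "a \<in> I" "b \<in> I" unfolding I by blast+
  then have "rdvd c a" "rdvd c b" using c unfolding rdvd_def by blast+
  ultimately show ?thesis unfolding I by blast
qed

text \<open>Scanning the numbers in increasing order, adjoin a ring element to the ideal generated so far
  whenever the result still has a common divisor in \<open>X\<close> that divides \<open>b\<close>. The state after \<open>n\<close> steps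
  is described by a single ring element \<open>c\<close> whose multiples below \<open>n\<close> are the adjoined elements, so
  that the construction is arithmetical without any coding of finite sequences.\<close>

lemma minimal_divisor:
  assumes X: "definable (\<lambda>e. X (e 0))" and up: "\<And>c d. X c \<Longrightarrow> rdvd c d \<Longrightarrow> X d"
    and b: "b \<in> carrier R" "X b"
  shows "\<exists>g. X g \<and> rdvd g b \<and> (\<forall>d. X d \<and> rdvd d g \<longrightarrow> rdvd g d)"
proof -
  \<comment> \<open>The second disjunct records a justified rejection: x is refused only if no
    admissible divisor of what was adjoined before x divides x as well.\<close>
  define G where "G n c \<longleftrightarrow> X c \<and> rdvd c b \<and> (\<forall>x. x \<prec> n \<and> x \<in> carrier R \<longrightarrow> rdvd c x \<or>
    (\<forall>f. X f \<and> rdvd f b \<and> (\<forall>y. y \<prec> x \<and> rdvd c y \<longrightarrow> rdvd f y) \<longrightarrow> \<not> rdvd f x))" for n c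
  note [definability] = definable1[OF X] carrier_set
  have GX: "X c" "rdvd c b" if "G n c" for n c
    using that unfolding G_def by auto
  have G: "rdvd c x \<or> \<not> rdvd f x" if "G n c" "x \<prec> n" "x \<in> carrier R" "X f" "rdvd f b"
    "\<And>y. y \<prec> x \<Longrightarrow> rdvd c y \<Longrightarrow> rdvd f y" for n c x f
    using that unfolding G_def by blast
  have anti: "G m c" if "G n c" "m \<preceq> n" for m n c
    using that O.less_le_trans unfolding G_def by blast
  have defG: "definable (\<lambda>e. G (e 0) (e (Suc 0)))"
    unfolding G_def by (intro definability)
  note [definability] = definable2[OF defG]
  \<comment> \<open>At the least disagreement m, the one of \<open>c\<close> and \<open>c'\<close>
    that divides m is a candidate against the rejection of m by the other. So the adjoined elements
    do not depend on the choice of \<open>c\<close>.\<close>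
  have coherent: "rdvd c x \<longleftrightarrow> rdvd c' x" if "G n c" "G n c'" "x \<prec> n" for n c c' x
  proof (rule ccontr)
    assume "\<not> (rdvd c x \<longleftrightarrow> rdvd c' x)"
    then have "x \<prec> n \<and> \<not> (rdvd c x \<longleftrightarrow> rdvd c' x)" using that by blast
    moreover have "definable (\<lambda>e. e 0 \<prec> n \<and> \<not> (rdvd c (e 0) \<longleftrightarrow> rdvd c' (e 0)))"
      by (intro definability)
    ultimately obtain m where m: "m \<prec> n" "\<not> (rdvd c m \<longleftrightarrow> rdvd c' m)"
      "\<And>k. k \<prec> m \<Longrightarrow> \<not> (k \<prec> n \<and> \<not> (rdvd c k \<longleftrightarrow> rdvd c' k))"
      using least[of "\<lambda>x. x \<prec> n \<and> \<not> (rdvd c x \<longleftrightarrow> rdvd c' x)"] by blast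
    have agree: "rdvd c k \<longleftrightarrow> rdvd c' k" if "k \<prec> m" for k
      using m(1) m(3)[OF that] O.less_trans that by blast
    have "m \<in> carrier R" using m(2) rdvd_carrier by blast
    then show False
      using G[OF that(1) m(1), of c'] G[OF that(2) m(1), of c] GX[OF that(1)] GX[OF that(2)] agree m(2)
      by blast
  qed
  have exG: "\<exists>c. G n c" for n
  proof (rule induct[where n = n], intro definability)
    show "\<exists>c. G \<^bold>0 c" using b rdvd_refl basic(7) unfolding G_def by blast
    fix n assume "\<exists>c. G n c"
    then obtain c where c: "G n c" by blast
    show "\<exists>c. G (n \<uplus> \<^bold>1) c"
    proof (cases "\<exists>f. \<not> rdvd c n \<and> X f \<and> rdvd f b \<and> (\<forall>y. y \<prec> n \<and> rdvd c y \<longrightarrow> rdvd f y) \<and> rdvd f n")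
      case False
      then have "G (n \<uplus> \<^bold>1) c"
        using c unfolding G_def basic(8) by blast
      then show ?thesis ..
    next
      case True
      then obtain f where f: "X f" "rdvd f b" "\<And>y. y \<prec> n \<Longrightarrow> rdvd c y \<Longrightarrow> rdvd f y" "rdvd f n" by blast
      \<comment> \<open>By greediness \<open>c\<close> already divides whatever an admissible
        \<open>f\<close> could add, so replacing \<open>c\<close> by \<open>f\<close> changes
        nothing below n.\<close>
      have same: "rdvd f y \<longleftrightarrow> rdvd c y" if "y \<prec> n" for y
      proof
        assume "rdvd f y"
        then show "rdvd c y"
          using G[OF c that _ f(1,2)] f(3) that O.less_trans rdvd_carrier(2) by blast
      qed (use f(3) that in blast)
      have "rdvd f x \<or> \<not> rdvd h x" if "x \<prec> n \<uplus> \<^bold>1" "x \<in> carrier R" "X h" "rdvd h b"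
        "\<And>y. y \<prec> x \<Longrightarrow> rdvd f y \<Longrightarrow> rdvd h y" for x h
      proof (cases "x = n")
        case False
        then have "x \<prec> n" using that(1) basic(8) by blast
        then show ?thesis
          using G[OF c _ that(2-4)] same that(5) O.less_trans by blast
      qed (use f(4) in blast)
      then have "G (n \<uplus> \<^bold>1) f" using f(1,2) unfolding G_def by blast
      then show ?thesis ..
    qed
  qed
  \<comment> \<open>Element x is decided at stage x + 1, whichever \<open>c\<close> describes that
    stage.\<close>
  define I where "I = {x. \<exists>c. G (x \<uplus> \<^bold>1) c \<and> rdvd c x}"
  have I_iff: "x \<in> I \<longleftrightarrow> rdvd c x" if "G n c" "x \<prec> n" for x n c
  proof -
    have "x \<uplus> \<^bold>1 \<preceq> n" using that(2) by (metis O.leI less_succ O.not_less)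
    then have "G (x \<uplus> \<^bold>1) c" using anti that(1) by blast
    moreover have "x \<prec> x \<uplus> \<^bold>1" using less_succ by blast
    ultimately show ?thesis unfolding I_def using coherent by blast
  qed
  have above: "\<exists>n c. G n c \<and> x \<prec> n \<and> y \<prec> n \<and> z \<prec> n" for x y z
  proof -
    have "x \<prec> O.max x (O.max y z) \<uplus> \<^bold>1" "y \<prec> O.max x (O.max y z) \<uplus> \<^bold>1" "z \<prec> O.max x (O.max y z) \<uplus> \<^bold>1"
      unfolding less_succ by (auto simp: O.le_max_iff_disj)
    then show ?thesis using exG by blast
  qed
  have "\<exists>g\<in>carrier R. \<forall>x. x \<in> I \<longleftrightarrow> (\<exists>r\<in>carrier R. x = g \<otimes> r)"
  proof (rule principal)
    show "I \<in> sets" unfolding I_def by (rule comprehension) (intro definability)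
    show "I \<subseteq> carrier R" unfolding I_def using rdvd_carrier by blast
    show "I \<noteq> {}" using exG[of "b \<uplus> \<^bold>1"] GX unfolding I_def by blast
    fix x y r s assume xy: "x \<in> I" "y \<in> I" and rs: "r \<in> carrier R" "s \<in> carrier R"
    obtain n c where n: "G n c" "x \<prec> n" "y \<prec> n" "x \<otimes> r \<oplus> y \<otimes> s \<prec> n" using above by blast
    then show "x \<otimes> r \<oplus> y \<otimes> s \<in> I"
      using I_iff[OF n(1)] xy rdvd_comb[OF _ _ rs] by blast
  qed
  then obtain g where g: "g \<in> carrier R" and "\<And>x. x \<in> I \<longleftrightarrow> (\<exists>r\<in>carrier R. x = g \<otimes> r)"
    by blast
  then have I: "x \<in> I \<longleftrightarrow> rdvd g x" for x
    by (auto simp: rdvd_def)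
  have "g \<in> I" using g I rdvd_refl by blast
  then have "X g" unfolding I_def using GX(1) up by blast
  moreover have "b \<in> I" using exG[of "b \<uplus> \<^bold>1"] GX unfolding I_def by blast
  then have "rdvd g b" using I by blast
  \<comment> \<open>Since d divides g, it divides everything adjoined before d, and it divides
    itself. So d was admissible when d was scanned, and greediness puts d into
    \<open>I\<close>.\<close>
  moreover have "rdvd g d" if d: "X d" "rdvd d g" for d
  proof -
    obtain n c where n: "G n c" "d \<prec> n" using above by blast
    have "rdvd d y" if "y \<prec> d" "rdvd c y" for y
      using I_iff[OF n(1)] that n(2) O.less_trans I rdvd_trans d(2) by blast
    moreover have "d \<in> carrier R" "rdvd d b"
      using d(2) rdvd_carrier rdvd_trans \<open>rdvd g b\<close> by blast+
    ultimately have "rdvd c d" using G[OF n] d(1) rdvd_refl by blast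
    then show ?thesis using I_iff[OF n] I by blast
  qed
  ultimately show ?thesis by blast
qed

section \<open>Boundedness of the divisors of a nonzero element\<close>

definition bounded_divisors :: "'a \<Rightarrow> bool" where
  "bounded_divisors b \<longleftrightarrow> (\<exists>N. \<forall>d. rdvd d b \<longrightarrow> (\<exists>d'. d' \<preceq> N \<and> rdvd d d' \<and> rdvd d' d))"

text \<open>The order of codes is unrelated to multiplication in the ring, so the bound is built as
  a running maximum.\<close>

lemma bounded_multiples:
  assumes p: "p \<in> carrier R"
  shows "\<exists>N'. N \<preceq> N' \<and> (\<forall>d. d \<preceq> N \<and> d \<in> carrier R \<longrightarrow> p \<otimes> d \<preceq> N')"
proof -
  have "\<exists>N'. N \<preceq> N' \<and> (\<forall>d w. d \<prec> n \<and> (p \<in> carrier R \<and> d \<in> carrier R \<and> w = p \<otimes> d) \<longrightarrow> w \<preceq> N')" for n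
  proof (rule induct[where n = n])
    show "definable (\<lambda>e. \<exists>N'. N \<preceq> N' \<and>
        (\<forall>d w. d \<prec> e 0 \<and> (p \<in> carrier R \<and> d \<in> carrier R \<and> w = p \<otimes> d) \<longrightarrow> w \<preceq> N'))"
      by (intro definable_Ex definable_All definable_Imp definable_And[OF _ definable_prod] definable_And[OF definable_le]
          definable_le definable_Less dterm_var dterm_const)
    show "\<exists>N'. N \<preceq> N' \<and> (\<forall>d w. d \<prec> \<^bold>0 \<and> (p \<in> carrier R \<and> d \<in> carrier R \<and> w = p \<otimes> d) \<longrightarrow> w \<preceq> N')"
      using basic(7) by blast
    fix n assume "\<exists>N'. N \<preceq> N' \<and> (\<forall>d w. d \<prec> n \<and> (p \<in> carrier R \<and> d \<in> carrier R \<and> w = p \<otimes> d) \<longrightarrow> w \<preceq> N')"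
    then obtain N' where N': "N \<preceq> N'" "\<And>d. d \<prec> n \<Longrightarrow> d \<in> carrier R \<Longrightarrow> p \<otimes> d \<preceq> N'" using p by blast
    let ?N = "O.max N' (p \<otimes> n)"
    have "N \<preceq> ?N" using N'(1) O.le_max_iff_disj by blast
    moreover have "p \<otimes> d \<preceq> ?N" if "d \<prec> n \<uplus> \<^bold>1" "d \<in> carrier R" for d
      using that N'(2) O.le_max_iff_disj unfolding basic(8) by blast
    ultimately show "\<exists>N'. N \<preceq> N' \<and> (\<forall>d w. d \<prec> n \<uplus> \<^bold>1 \<and> (p \<in> carrier R \<and> d \<in> carrier R \<and> w = p \<otimes> d) \<longrightarrow> w \<preceq> N')"
      by blast
  qed
  from this[of "N \<uplus> \<^bold>1"] show ?thesis unfolding less_succ using p by blast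
qed

text \<open>Let g be minimal with unbounded divisors and p a minimal nonunit dividing g = p f; the
  divisors of f are bounded. A divisor d of g is either p c with c dividing f, or coprime to p and
  then itself a divisor of f. Codes c' up to N for f thus give the codes p c' and c' for g.\<close>

lemma divisors_bounded:
  assumes b: "b \<in> carrier R" "b \<noteq> \<zero>" shows "bounded_divisors b"
proof (rule ccontr)
  assume "\<not> bounded_divisors b"
  let ?X = "\<lambda>b. b \<in> carrier R \<and> \<not> bounded_divisors b"
  have "\<exists>g. ?X g \<and> rdvd g b \<and> (\<forall>d. ?X d \<and> rdvd d g \<longrightarrow> rdvd g d)"
  proof (rule minimal_divisor[of ?X])
    show "definable (\<lambda>e. e 0 \<in> carrier R \<and> \<not> bounded_divisors (e 0))"
      unfolding bounded_divisors_def by (intro definability carrier_set)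
    show "?X d" if "?X c" "rdvd c d" for c d
      using that rdvd_trans rdvd_carrier unfolding bounded_divisors_def by blast
  qed (use \<open>\<not> bounded_divisors b\<close> b in auto)
  then obtain g where g: "?X g" "rdvd g b" "\<And>d. ?X d \<Longrightarrow> rdvd d g \<Longrightarrow> rdvd g d" by blast
  have g0: "g \<noteq> \<zero>" using g(2) b unfolding rdvd_def by auto
  let ?U = "\<lambda>b. b \<in> carrier R \<and> \<not> rdvd b \<one>"
  have unit: "rdvd u x" if "rdvd u \<one>" "x \<in> carrier R" for u x
    using that rdvd_trans rdvd_mult[of \<one> x] by simp
  have "?U g"
  proof -
    \<comment> \<open>All divisors of a unit are associates of \<open>\<one>\<close>, so the code of
      \<open>\<one>\<close> is a bound.\<close>
    have "bounded_divisors g" if "rdvd g \<one>"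
      unfolding bounded_divisors_def
    proof (rule exI[of _ \<one>], intro allI impI)
      fix d assume "rdvd d g"
      then have "rdvd d \<one>" "rdvd \<one> d" using that rdvd_trans unit rdvd_refl rdvd_carrier by blast+
      then show "\<exists>d'. d' \<preceq> \<one> \<and> rdvd d d' \<and> rdvd d' d" by blast
    qed
    then show ?thesis using g(1) by blast
  qed
  have "\<exists>p. ?U p \<and> rdvd p g \<and> (\<forall>d. ?U d \<and> rdvd d p \<longrightarrow> rdvd p d)"
  proof (rule minimal_divisor[of ?U])
    show "definable (\<lambda>e. e 0 \<in> carrier R \<and> \<not> rdvd (e 0) \<one>)"
      by (intro definability carrier_set)
    show "?U d" if "?U c" "rdvd c d" for c d
      using that rdvd_trans rdvd_carrier by blast
  qed (use \<open>?U g\<close> in auto)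
  then obtain p where p: "?U p" "rdvd p g" "\<And>d. ?U d \<Longrightarrow> rdvd d p \<Longrightarrow> rdvd p d" by blast
  then obtain f where f: "f \<in> carrier R" "g = p \<otimes> f" unfolding rdvd_def by blast
  have pc: "p \<in> carrier R" using p(1) ..
  have f0: "f \<noteq> \<zero>" using g0 f pc by auto
  have fg: "rdvd f g" using f rdvd_mult[of f p] pc by (simp add: m_comm)
  \<comment> \<open>Otherwise cancelling f from f = f p k would make p a unit.\<close>
  have "\<not> rdvd g f"
  proof
    assume "rdvd g f"
    then obtain k where k: "k \<in> carrier R" "f = g \<otimes> k" unfolding rdvd_def by blast
    then have "f \<otimes> \<one> = f \<otimes> (p \<otimes> k)" using f pc by (simp add: m_ac)
    then have "\<one> = p \<otimes> k" using cancel_left[OF f(1) _ _ f0] pc k by simp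
    then show False using p(1) k pc rdvd_mult[of p k] by simp
  qed
  then have "bounded_divisors f" using g(3) fg f(1) by blast
  then obtain N where N: "\<And>d. rdvd d f \<Longrightarrow> \<exists>d'. d' \<preceq> N \<and> rdvd d d' \<and> rdvd d' d"
    unfolding bounded_divisors_def by blast
  obtain N' where N': "N \<preceq> N'" "\<And>d. d \<preceq> N \<Longrightarrow> d \<in> carrier R \<Longrightarrow> p \<otimes> d \<preceq> N'"
    using bounded_multiples[OF pc] by blast
  have p_mono: "rdvd (p \<otimes> x) (p \<otimes> y)" if "rdvd x y" for x y
    using that pc unfolding rdvd_def by (auto simp: m_assoc)
  have "\<exists>d'. d' \<preceq> N' \<and> rdvd d d' \<and> rdvd d' d" if d: "rdvd d g" for d
  proof (cases "rdvd p d")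
    case True
    then obtain c where c: "c \<in> carrier R" "d = p \<otimes> c" unfolding rdvd_def by blast
    obtain k where k: "k \<in> carrier R" "g = d \<otimes> k" using d unfolding rdvd_def by blast
    have p0: "p \<noteq> \<zero>" using g0 f by auto
    have "p \<otimes> f = p \<otimes> (c \<otimes> k)" using f(2) k(2) c pc k(1) by (simp add: m_assoc)
    then have "f = c \<otimes> k" using cancel_left[OF pc f(1) _ p0] c k by simp
    then have "rdvd c f" using c k rdvd_mult by simp
    then obtain c' where "c' \<preceq> N" "rdvd c c'" "rdvd c' c" using N by blast
    then show ?thesis
      using N'(2)[of c'] p_mono rdvd_carrier c(2) by blast
  next
    case False
    have dc: "d \<in> carrier R" using d rdvd_carrier by blast
    obtain x y where xy: "x \<in> carrier R" "y \<in> carrier R"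
      "rdvd (p \<otimes> x \<oplus> d \<otimes> y) p" "rdvd (p \<otimes> x \<oplus> d \<otimes> y) d"
      using bezout[OF pc dc] by blast
    let ?u = "p \<otimes> x \<oplus> d \<otimes> y"
    \<comment> \<open>A nonunit \<open>?u\<close> would be divisible by p, by minimality of p, and
      then p would divide d.\<close>
    have "rdvd ?u \<one>"
      using p(3)[of ?u] xy False rdvd_trans rdvd_carrier by blast
    then obtain k where k: "k \<in> carrier R" "\<one> = ?u \<otimes> k" unfolding rdvd_def by blast
    \<comment> \<open>Multiplying 1 = (p x + d y) k by f turns f p into g, so both summands become
      multiples of d.\<close>
    have "f = f \<otimes> (?u \<otimes> k)" using f(1) by (simp flip: k(2))
    also have "\<dots> = g \<otimes> (x \<otimes> k) \<oplus> d \<otimes> (f \<otimes> (y \<otimes> k))"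
      unfolding f(2) using f(1) pc dc xy(1,2) k(1) by algebra
    finally have "f = \<dots>" .
    moreover have "rdvd d (g \<otimes> (x \<otimes> k) \<oplus> d \<otimes> (f \<otimes> (y \<otimes> k)))"
      using rdvd_comb[OF d rdvd_refl[OF dc]] xy(1,2) k(1) f(1) by simp
    ultimately have "rdvd d f" by metis
    then show ?thesis using N N'(1) O.order_trans by blast
  qed
  then show False using g(1) unfolding bounded_divisors_def by blast
qed

end

section \<open>The norm\<close>

context sigma1_PID
begin

text \<open>Least codes select one modulus per class of associates. A class may be unbounded, and
  unboundedly many moduli have no nonzero common multiple.\<close>

definition rep :: "'a \<Rightarrow> bool"
  where "rep i \<longleftrightarrow> i \<in> carrier R \<and> (\<forall>j. j \<prec> i \<longrightarrow> \<not> (rdvd i j \<and> rdvd j i))"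

text \<open>The number \<open>m\<close> is chosen anew for each \<open>b\<close>, but one that serves \<open>b\<close> also serves every divisor of \<open>b\<close>.\<close>

definition norm_bound :: "'a \<Rightarrow> 'a \<Rightarrow> bool" where
  "norm_bound b v \<longleftrightarrow> v \<noteq> \<^bold>0 \<and> (\<exists>m. m \<noteq> \<^bold>0 \<and>
     (\<forall>i s. rep i \<and> rdvd i b \<and> s \<noteq> \<^bold>0 \<and> s \<preceq> i \<longrightarrow> mdvd s m) \<and>
     (\<forall>i. rep i \<and> rdvd i b \<longrightarrow> mdvd (\<^bold>1 \<uplus> (i \<uplus> \<^bold>1) \<odot> m) v))"

definition norm_is :: "'a \<Rightarrow> 'a \<Rightarrow> bool" where
  "norm_is b v \<longleftrightarrow> b \<in> carrier R \<and>
     (b = \<zero> \<and> v = \<^bold>0 \<or> b \<noteq> \<zero> \<and> norm_bound b v \<and> (\<forall>w. w \<prec> v \<longrightarrow> \<not> norm_bound b w))"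

lemma definable_norm_bound [definability]:
  assumes "dterm t" "dterm u" shows "definable (\<lambda>e. norm_bound (t e) (u e))"
proof (rule definable2[of norm_bound, OF _ assms])
  show "definable (\<lambda>e. norm_bound (e 0) (e (Suc 0)))"
    unfolding norm_bound_def rep_def by (intro definability carrier_set)
qed

lemma definable_norm_is:
  assumes "dterm t" "dterm u" shows "definable (\<lambda>e. norm_is (t e) (u e))"
proof (rule definable2[of norm_is, OF _ assms])
  show "definable (\<lambda>e. norm_is (e 0) (e (Suc 0)))"
    unfolding norm_is_def by (intro definability carrier_set)
qed

lemma exists_rep:
  assumes "b \<in> carrier R"
  shows "\<exists>i. rep i \<and> rdvd i b \<and> rdvd b i"
proof -
  have "definable (\<lambda>e. rdvd (e 0) b \<and> rdvd b (e 0))" by (intro definability)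
  from least[OF this, of b] obtain i where
    i: "rdvd i b" "rdvd b i" "\<And>k. k \<prec> i \<Longrightarrow> \<not> (rdvd k b \<and> rdvd b k)"
    using assms rdvd_refl by blast
  then have "rep i" unfolding rep_def using rdvd_carrier rdvd_trans by blast
  then show ?thesis using i by blast
qed

lemma norm_bound_exists:
  assumes "b \<in> carrier R" "b \<noteq> \<zero>" shows "\<exists>v. norm_bound b v"
proof -
  obtain N where N: "\<And>d. rdvd d b \<Longrightarrow> \<exists>d'. d' \<preceq> N \<and> rdvd d d' \<and> rdvd d' d"
    using divisors_bounded[OF assms] unfolding bounded_divisors_def by blast
  \<comment> \<open>A representative is least in its class, and the class has a member up to
    N.\<close>
  have rep_le: "i \<preceq> N" if "rep i" "rdvd i b" for i
    using that N[OF that(2)] unfolding rep_def by (meson O.le_less_linear O.less_le_trans O.not_le O.order_trans)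
  obtain m where m: "m \<noteq> \<^bold>0" "\<And>s. s \<preceq> N \<Longrightarrow> s \<noteq> \<^bold>0 \<Longrightarrow> mdvd s m"
    using common_multiple[of "\<lambda>s. s" N] by blast
  have "\<exists>v. v \<noteq> \<^bold>0 \<and> (\<forall>i. i \<preceq> N \<and> \<^bold>1 \<uplus> (i \<uplus> \<^bold>1) \<odot> m \<noteq> \<^bold>0 \<longrightarrow> mdvd (\<^bold>1 \<uplus> (i \<uplus> \<^bold>1) \<odot> m) v)"
    by (rule common_multiple) (intro definability)
  then obtain v where v: "v \<noteq> \<^bold>0" "\<And>i. i \<preceq> N \<Longrightarrow> mdvd (\<^bold>1 \<uplus> (i \<uplus> \<^bold>1) \<odot> m) v"
    by (auto simp: add_eq_zero)
  have "norm_bound b v"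
    unfolding norm_bound_def using v m rep_le O.order_trans by blast
  then show ?thesis ..
qed

lemma norm_is_exists: "b \<in> carrier R \<Longrightarrow> \<exists>v. norm_is b v"
  using norm_bound_exists[of b] least[of "norm_bound b"] definable_norm_bound[OF dterm_const dterm_var]
  unfolding norm_is_def by blast

lemma norm_is_unique: "norm_is b v \<Longrightarrow> norm_is b w \<Longrightarrow> v = w"
  unfolding norm_is_def using O.less_linear by blast

lemma norm_is_zero: "b \<in> carrier R \<Longrightarrow> norm_is b \<^bold>0 \<longleftrightarrow> b = \<zero>"
  unfolding norm_is_def norm_bound_def by blast

lemma norm_bound_divisor: "rdvd a b \<Longrightarrow> norm_bound b v \<Longrightarrow> norm_bound a v"
  unfolding norm_bound_def using rdvd_trans by meson

text \<open>If \<open>a\<close> divides \<open>b\<close> properly, the factor belonging to the representative of \<open>b\<close> is coprime to all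
  factors belonging to divisors of \<open>a\<close>, so it can be cancelled from \<open>v\<close>.\<close>

lemma norm_bound_proper_divisor:
  assumes ab: "rdvd a b" "\<not> rdvd b a" and v: "norm_bound b v"
  shows "\<exists>w. w \<prec> v \<and> norm_bound a w"
proof -
  obtain m where m: "v \<noteq> \<^bold>0" "m \<noteq> \<^bold>0" "\<And>i s. rep i \<Longrightarrow> rdvd i b \<Longrightarrow> s \<noteq> \<^bold>0 \<Longrightarrow> s \<preceq> i \<Longrightarrow> mdvd s m"
    "\<And>i. rep i \<Longrightarrow> rdvd i b \<Longrightarrow> mdvd (\<^bold>1 \<uplus> (i \<uplus> \<^bold>1) \<odot> m) v"
    using v unfolding norm_bound_def by blast
  obtain j where j: "rep j" "rdvd j b" "rdvd b j"
    using exists_rep ab(1) rdvd_carrier by blast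
  obtain w where w: "v = (\<^bold>1 \<uplus> (j \<uplus> \<^bold>1) \<odot> m) \<odot> w"
    using m(4) j unfolding mdvd_def by blast
  have w0: "w \<noteq> \<^bold>0" using m(1) w by auto
  \<comment> \<open>The factor exceeds 1, even for the code j = 0, because j + 1 and m are
    nonzero.\<close>
  have "w \<prec> v" unfolding w
    by (rule less_mult) (use w0 m(2) basic(1) in \<open>auto simp: mult_eq_zero\<close>)
  moreover have "mdvd (\<^bold>1 \<uplus> (i \<uplus> \<^bold>1) \<odot> m) w" if i: "rep i" "rdvd i a" for i
  proof (rule mdvd_cancel_coprime[of _ "j \<uplus> \<^bold>1"])
    have ib: "rdvd i b" using i(2) ab(1) rdvd_trans by blast
    have ij: "i \<noteq> j" using i(2) j(3) ab(2) rdvd_trans by blast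
    show "mdvd (\<^bold>1 \<uplus> (i \<uplus> \<^bold>1) \<odot> m) ((\<^bold>1 \<uplus> (j \<uplus> \<^bold>1) \<odot> m) \<odot> w)"
      using m(4)[OF i(1) ib] w by simp
    fix s assume "i \<uplus> \<^bold>1 = j \<uplus> \<^bold>1 \<uplus> s \<or> j \<uplus> \<^bold>1 = i \<uplus> \<^bold>1 \<uplus> s"
    then have "i \<uplus> \<^bold>1 = s \<uplus> j \<uplus> \<^bold>1 \<or> j \<uplus> \<^bold>1 = s \<uplus> i \<uplus> \<^bold>1"
      by (simp add: ac_simps)
    then have s: "i = s \<uplus> j \<or> j = s \<uplus> i" unfolding add_cancel_right .
    then have "s \<noteq> \<^bold>0" using ij by auto
    \<comment> \<open>The difference of two codes is at most the larger one, and both codes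
      represent divisors of b, so the choice of m covers s.\<close>
    moreover have "s \<preceq> i \<or> s \<preceq> j" using s unfolding le_iff by blast
    ultimately show "mdvd s m" using m(3) i(1) ib j by blast
  qed
  then have "norm_bound a w"
    unfolding norm_bound_def using w0 m(2,3) ab(1) rdvd_trans by blast
  ultimately show ?thesis by blast
qed

text \<open>A bound for \<open>b\<close> is also a bound for \<open>a\<close>, so the least ones
  compare; this yields the clause f(a) <= f(ab).\<close>

lemma norm_is_mono:
  assumes "rdvd a b" "b \<noteq> \<zero>" "norm_is a m" "norm_is b n" shows "m \<preceq> n"
proof -
  have "a \<noteq> \<zero>" using assms unfolding rdvd_def by auto
  then show ?thesis
    using assms norm_bound_divisor O.not_less unfolding norm_is_def by blast
qed

lemma norm_is_strict_mono:
  assumes "rdvd a b" "\<not> rdvd b a" "b \<noteq> \<zero>" "norm_is a m" "norm_is b n"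
  shows "\<^bold>0 \<prec> m" "m \<prec> n"
proof -
  have a: "a \<noteq> \<zero>" using assms unfolding rdvd_def by auto
  then show "\<^bold>0 \<prec> m" using assms(4) unfolding norm_is_def norm_bound_def zero_less by blast
  obtain w where "w \<prec> n" "norm_bound a w"
    using norm_bound_proper_divisor[OF assms(1,2)] assms(3,5) unfolding norm_is_def by blast
  then show "m \<prec> n"
    using a assms(4) O.not_less O.le_less_trans unfolding norm_is_def by blast
qed

text \<open>A generator of (a, b) divides b, and properly, since otherwise b would divide a. Strict
  monotonicity then applies.\<close>

lemma norm_is_Dedekind_Hasse:
  assumes "a \<in> carrier R" "b \<in> carrier R" "b \<noteq> \<zero>" "\<not> rdvd b a"
  shows "\<exists>x y m n. x \<in> carrier R \<and> y \<in> carrier R \<and> norm_is (a \<otimes> x \<oplus> b \<otimes> y) m \<and> norm_is b n \<and>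
    \<^bold>0 \<prec> m \<and> m \<prec> n"
proof -
  obtain x y where xy: "x \<in> carrier R" "y \<in> carrier R"
    "rdvd (a \<otimes> x \<oplus> b \<otimes> y) a" "rdvd (a \<otimes> x \<oplus> b \<otimes> y) b"
    using bezout[OF assms(1,2)] by blast
  then have "\<not> rdvd b (a \<otimes> x \<oplus> b \<otimes> y)" using assms(4) rdvd_trans by blast
  moreover obtain m n where "norm_is (a \<otimes> x \<oplus> b \<otimes> y) m" "norm_is b n"
    using norm_is_exists assms xy by (metis a_closed m_closed)
  ultimately show ?thesis using norm_is_strict_mono[OF xy(4) _ assms(3)] xy by blast
qed

end

section \<open>Semantics of the formalised statement\<close>

context so_structure
begin

text \<open>Named binding evaluates to a function update, so the simplifier can turn the encoded
  formulas into plain statements about the model.\<close>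

lemma sat_bindN: "sat (case_nat a e) E (bindN x p) \<longleftrightarrow> sat (e(x := a)) E p"
proof -
  have "(\<lambda>n. eval (case_nat a e) (if n = x then Var 0 else Var (Suc n))) = e(x := a)"
    by (simp add: fun_eq_iff)
  then show ?thesis by (simp add: bindN_def sat_subst)
qed

lemma sat_bindS: "sat e (case_nat A E) (bindS X p) \<longleftrightarrow> sat e (E(X := A)) p"
proof -
  have "(\<lambda>Y. case_nat A E (if Y = X then 0 else Suc Y)) = E(X := A)"
    by (simp add: fun_eq_iff)
  then show ?thesis by (simp add: bindS_def sat_subst)
qed

lemma sat_all_n [simp]:
  "sat e E (all_n [] p) \<longleftrightarrow> sat e E p"
  "sat e E (all_n (x # xs) p) \<longleftrightarrow> (\<forall>a. sat (e(x := a)) E (all_n xs p))"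
  by (simp_all add: all_n_def sat_bindN)

lemma sat_ex_n [simp]:
  "sat e E (ex_n [] p) \<longleftrightarrow> sat e E p"
  "sat e E (ex_n (x # xs) p) \<longleftrightarrow> (\<exists>a. sat (e(x := a)) E (ex_n xs p))"
  by (simp_all add: ex_n_def sat_bindN)

lemma sat_all_s [simp]:
  "sat e E (all_s [] p) \<longleftrightarrow> sat e E p"
  "sat e E (all_s (X # Xs) p) \<longleftrightarrow> (\<forall>A\<in>sets. sat e (E(X := A)) (all_s Xs p))"
  by (simp_all add: all_s_def sat_bindS)

lemma sat_ex_s [simp]:
  "sat e E (ex_s [] p) \<longleftrightarrow> sat e E p"
  "sat e E (ex_s (X # Xs) p) \<longleftrightarrow> (\<exists>A\<in>sets. sat e (E(X := A)) (ex_s Xs p))"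
  by (simp_all add: ex_s_def sat_bindS)

lemma sat_conjs [simp]:
  "sat e E (conjs []) \<longleftrightarrow> True"
  "sat e E (conjs (p # ps)) \<longleftrightarrow> sat e E p \<and> sat e E (conjs ps)"
  by (simp_all add: conjs_def)

end

context aca_model
begin

lemma sat_in_ring [simp]: "sat e E (in_ring a) \<longleftrightarrow> e a \<in> E 0"
  by (simp add: in_ring_def)

lemma sat_eq_var [simp]: "sat e E (eq_var a b) \<longleftrightarrow> e a = e b"
  by (simp add: eq_var_def)

lemma sat_nonzero [simp]: "sat e E (nonzero a) \<longleftrightarrow> e a \<in> E 0 \<and> e a \<noteq> e 0"
  by (simp add: nonzero_def)

lemma sat_maps2_to [simp]: "sat e E (maps2_to X a b c) \<longleftrightarrow> pair (pair (e a) (e b)) (e c) \<in> E X"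
  by (simp add: maps2_to_def)

lemma sat_maps_to [simp]: "sat e E (maps_to X a b) \<longleftrightarrow> pair (e a) (e b) \<in> E X"
  by (simp add: maps_to_def)

lemma sat_sum_is [simp]: "sat e E (sum_is a b c) \<longleftrightarrow> pair (pair (e a) (e b)) (e c) \<in> E 1"
  by (simp add: sum_is_def)

lemma sat_prod_is [simp]: "sat e E (prod_is a b c) \<longleftrightarrow> pair (pair (e a) (e b)) (e c) \<in> E 2"
  by (simp add: prod_is_def)

section \<open>From encoded operations to a ring in the sense of \<open>HOL-Algebra\<close>\<close>

definition binop_graph :: "'a set \<Rightarrow> 'a set \<Rightarrow> bool" where
  "binop_graph C G \<longleftrightarrow>
    (\<forall>w. w \<in> G \<longrightarrow> (\<exists>a b c. a \<in> C \<and> b \<in> C \<and> c \<in> C \<and> w = pair (pair a b) c)) \<and>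
    (\<forall>a b. a \<in> C \<and> b \<in> C \<longrightarrow> (\<exists>c. c \<in> C \<and> pair (pair a b) c \<in> G)) \<and>
    (\<forall>a b c c'. pair (pair a b) c \<in> G \<and> pair (pair a b) c' \<in> G \<longrightarrow> c = c')"

lemma sat_is_binop [simp]: "sat e E (is_binop X) \<longleftrightarrow> binop_graph (E 0) (E X)"
  by (simp add: is_binop_def binop_graph_def Let_def)

text \<open>Off the carrier the value is unspecified; uses are guarded by membership in the
  carrier.\<close>

definition graph_op :: "'a set \<Rightarrow> 'a \<Rightarrow> 'a \<Rightarrow> 'a"
  where "graph_op G a b = (THE c. pair (pair a b) c \<in> G)"

lemma binop_graph_op:
  assumes "binop_graph C G"
  shows "a \<in> C \<Longrightarrow> b \<in> C \<Longrightarrow> graph_op G a b \<in> C"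
    and "pair (pair a b) c \<in> G \<longleftrightarrow> a \<in> C \<and> b \<in> C \<and> c = graph_op G a b"
    and "G = {pair (pair a b) (graph_op G a b) |a b. a \<in> C \<and> b \<in> C}"
proof -
  have G: "\<And>w. w \<in> G \<Longrightarrow> \<exists>a b c. a \<in> C \<and> b \<in> C \<and> c \<in> C \<and> w = pair (pair a b) c"
    "\<And>a b. a \<in> C \<Longrightarrow> b \<in> C \<Longrightarrow> \<exists>c. c \<in> C \<and> pair (pair a b) c \<in> G"
    "\<And>a b c c'. pair (pair a b) c \<in> G \<Longrightarrow> pair (pair a b) c' \<in> G \<Longrightarrow> c = c'"
    using assms unfolding binop_graph_def by blast+
  have op: "graph_op G a b = c" if "pair (pair a b) c \<in> G" for a b c
    unfolding graph_op_def using that G(3) by blast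
  show closed: "graph_op G a b \<in> C" if "a \<in> C" "b \<in> C" for a b
    using G(2)[OF that] op by blast
  show iff: "pair (pair a b) c \<in> G \<longleftrightarrow> a \<in> C \<and> b \<in> C \<and> c = graph_op G a b" for a b c
    using G(1)[of "pair (pair a b) c"] G(2)[of a b] op by auto
  show "G = {pair (pair a b) (graph_op G a b) |a b. a \<in> C \<and> b \<in> C}"
  proof (intro equalityI subsetI)
    fix w assume w: "w \<in> G"
    then obtain a b c where "w = pair (pair a b) c" using G(1) by blast
    then show "w \<in> {pair (pair a b) (graph_op G a b) |a b. a \<in> C \<and> b \<in> C}"
      using w iff by auto
  qed (auto simp: iff)
qed

definition ring_of :: "(nat \<Rightarrow> 'a) \<Rightarrow> (nat \<Rightarrow> 'a set) \<Rightarrow> 'a ring" where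
  "ring_of e E = \<lparr>carrier = E 0, mult = graph_op (E 2), one = e 1, zero = e 0, add = graph_op (E 1)\<rparr>"

lemma sat_is_comm_ring:
  assumes "sat e E is_comm_ring"
  shows "binop_graph (E 0) (E 1)" "binop_graph (E 0) (E 2)" "cring (ring_of e E)"
proof -
  have "sat e E is_comm_ring \<longleftrightarrow> e 0 \<in> E 0 \<and> e 1 \<in> E 0 \<and> binop_graph (E 0) (E 1) \<and> binop_graph (E 0) (E 2) \<and>
    (\<forall>a b c u v w. pair (pair a b) u \<in> E 1 \<and> pair (pair u c) w \<in> E 1 \<and> pair (pair b c) v \<in> E 1 \<longrightarrow> pair (pair a v) w \<in> E 1) \<and>
    (\<forall>a b c. pair (pair a b) c \<in> E 1 \<longrightarrow> pair (pair b a) c \<in> E 1) \<and>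
    (\<forall>a. a \<in> E 0 \<longrightarrow> pair (pair a (e 0)) a \<in> E 1) \<and>
    (\<forall>a. a \<in> E 0 \<longrightarrow> (\<exists>b. b \<in> E 0 \<and> pair (pair a b) (e 0) \<in> E 1)) \<and>
    (\<forall>a b c u v w. pair (pair a b) u \<in> E 2 \<and> pair (pair u c) w \<in> E 2 \<and> pair (pair b c) v \<in> E 2 \<longrightarrow> pair (pair a v) w \<in> E 2) \<and>
    (\<forall>a b c. pair (pair a b) c \<in> E 2 \<longrightarrow> pair (pair b a) c \<in> E 2) \<and>
    (\<forall>a. a \<in> E 0 \<longrightarrow> pair (pair a (e 1)) a \<in> E 2) \<and>
    (\<forall>a b c u v w d. pair (pair b c) u \<in> E 1 \<and> pair (pair a u) d \<in> E 2 \<and> pair (pair a b) v \<in> E 2 \<and> pair (pair a c) w \<in> E 2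
       \<longrightarrow> pair (pair v w) d \<in> E 1)"
    by (simp add: is_comm_ring_def Let_def)
  note ax = this[THEN iffD1, OF assms]
  from ax show B: "binop_graph (E 0) (E 1)" "binop_graph (E 0) (E 2)" by - (elim conjE, assumption)+
  note op = binop_graph_op(1,2)[OF B(1)] binop_graph_op(1,2)[OF B(2)]
  let ?p = "graph_op (E 1)" and ?t = "graph_op (E 2)"
  from ax have z: "e 0 \<in> E 0" and u: "e 1 \<in> E 0" by - (elim conjE, assumption)+
  from ax have add_assoc: "\<forall>a b c u v w. pair (pair a b) u \<in> E 1 \<and> pair (pair u c) w \<in> E 1 \<and> pair (pair b c) v \<in> E 1 \<longrightarrow> pair (pair a v) w \<in> E 1"
    by (elim conjE)
  from ax have add_comm: "\<forall>a b c. pair (pair a b) c \<in> E 1 \<longrightarrow> pair (pair b a) c \<in> E 1" by (elim conjE)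
  from ax have add_zero: "\<forall>a. a \<in> E 0 \<longrightarrow> pair (pair a (e 0)) a \<in> E 1" by (elim conjE)
  from ax have add_inv: "\<forall>a. a \<in> E 0 \<longrightarrow> (\<exists>b. b \<in> E 0 \<and> pair (pair a b) (e 0) \<in> E 1)" by (elim conjE)
  from ax have mult_assoc: "\<forall>a b c u v w. pair (pair a b) u \<in> E 2 \<and> pair (pair u c) w \<in> E 2 \<and> pair (pair b c) v \<in> E 2 \<longrightarrow> pair (pair a v) w \<in> E 2"
    by (elim conjE)
  from ax have mult_comm: "\<forall>a b c. pair (pair a b) c \<in> E 2 \<longrightarrow> pair (pair b a) c \<in> E 2" by (elim conjE)
  from ax have mult_one: "\<forall>a. a \<in> E 0 \<longrightarrow> pair (pair a (e 1)) a \<in> E 2" by (elim conjE)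
  from ax have distrib: "\<forall>a b c u v w d. pair (pair b c) u \<in> E 1 \<and> pair (pair a u) d \<in> E 2 \<and> pair (pair a b) v \<in> E 2 \<and> pair (pair a c) w \<in> E 2
       \<longrightarrow> pair (pair v w) d \<in> E 1" by (elim conjE)
  \<comment> \<open>The encoded axioms are relational; instantiating their result variables with
    values of \<open>graph_op\<close> turns them into equations.\<close>
  have pa: "?p (?p a b) c = ?p a (?p b c)" if "a \<in> E 0" "b \<in> E 0" "c \<in> E 0" for a b c
    using add_assoc[rule_format, of a b "?p a b" c "?p (?p a b) c" "?p b c"] that op(1,3) unfolding op(2,4) by simp
  have pc: "?p a b = ?p b a" if "a \<in> E 0" "b \<in> E 0" for a b
    using add_comm[rule_format, of a b "?p a b"] that op(1,3) unfolding op(2,4) by simp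
  have p0: "?p a (e 0) = a" if "a \<in> E 0" for a
    using add_zero[rule_format, of a] that op(1,3) unfolding op(2,4) by simp
  have pi: "\<exists>b\<in>E 0. ?p b a = e 0" if "a \<in> E 0" for a
    using add_inv[rule_format, OF that] pc that unfolding op(2) by metis
  have ta: "?t (?t a b) c = ?t a (?t b c)" if "a \<in> E 0" "b \<in> E 0" "c \<in> E 0" for a b c
    using mult_assoc[rule_format, of a b "?t a b" c "?t (?t a b) c" "?t b c"] that op(1,3) unfolding op(2,4) by simp
  have tc: "?t a b = ?t b a" if "a \<in> E 0" "b \<in> E 0" for a b
    using mult_comm[rule_format, of a b "?t a b"] that op(1,3) unfolding op(2,4) by simp
  have t1: "?t a (e 1) = a" if "a \<in> E 0" for a
    using mult_one[rule_format, of a] that op(1,3) unfolding op(2,4) by simp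
  have td: "?t a (?p b c) = ?p (?t a b) (?t a c)" if "a \<in> E 0" "b \<in> E 0" "c \<in> E 0" for a b c
    using distrib[rule_format, of b c "?p b c" a "?t a (?p b c)" "?t a b" "?t a c"] that op(1,3) unfolding op(2,4) by simp
  show "cring (ring_of e E)"
  proof (rule cringI)
    show "abelian_group (ring_of e E)"
      by (rule abelian_groupI) (use op(1) z pa pc p0 pi in \<open>auto simp: ring_of_def\<close>)
    show "comm_monoid (ring_of e E)"
      by (rule comm_monoidI) (use op(3) u ta tc t1 in \<open>auto simp: ring_of_def\<close>)
    show "(x \<oplus>\<^bsub>ring_of e E\<^esub> y) \<otimes>\<^bsub>ring_of e E\<^esub> w =
        x \<otimes>\<^bsub>ring_of e E\<^esub> w \<oplus>\<^bsub>ring_of e E\<^esub> y \<otimes>\<^bsub>ring_of e E\<^esub> w"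
      if "x \<in> carrier (ring_of e E)" "y \<in> carrier (ring_of e E)" "w \<in> carrier (ring_of e E)" for x y w
      using that td[of w x y] tc op(1) by (simp add: ring_of_def)
  qed
qed

lemma sat_is_sigma1_PID:
  assumes sat: "sat e E is_sigma1_PID" and E: "\<forall>X. E X \<in> sets"
  shows "sigma1_PID \<^bold>0 \<^bold>1 (\<uplus>) (\<odot>) (\<prec>) sets (ring_of e E)"
proof -
  \<comment> \<open>The disjunction at the end is what simplification makes of one half of the
    encoded biconditional.\<close>
  have "sat e E is_sigma1_PID \<longleftrightarrow> sat e E is_comm_ring \<and>
     (\<forall>a b. pair (pair a b) (e 0) \<in> E 2 \<longrightarrow> (a \<noteq> e 0 \<longrightarrow> b = e 0)) \<and>
     (\<forall>F\<in>sets. sat e (E(3 := F)) is_sigma1_ideal \<longrightarrow>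
       (\<exists>c. c \<in> E 0 \<and> (\<forall>x. ((\<exists>k. pair k x \<in> F) \<longrightarrow> (\<exists>r. r \<in> E 0 \<and> pair (pair c r) x \<in> E 2)) \<and>
         ((\<forall>r. r \<in> E 0 \<longrightarrow> pair (pair c r) x \<notin> E 2) \<or> (\<exists>k. pair k x \<in> F)))))"
    by (simp add: is_sigma1_PID_def is_integral_domain_def Let_def)
  note pid = this[THEN iffD1, OF sat]
  then have ring: "sat e E is_comm_ring" by blast
  note B = sat_is_comm_ring(1,2)[OF ring]
  interpret R: cring "ring_of e E" by (rule sat_is_comm_ring(3)[OF ring])
  have op: "carrier (ring_of e E) = E 0" "add (ring_of e E) = graph_op (E 1)" "mult (ring_of e E) = graph_op (E 2)"
    "zero (ring_of e E) = e 0" by (simp_all add: ring_of_def)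
  note iff = binop_graph_op(2)[OF B(1)] binop_graph_op(2)[OF B(2)]
  show ?thesis
  proof
    show "carrier (ring_of e E) \<in> sets" using E by (simp add: op)
    show "{pair (pair a b) (a \<oplus>\<^bsub>ring_of e E\<^esub> b) |a b. a \<in> carrier (ring_of e E) \<and> b \<in> carrier (ring_of e E)} \<in> sets"
      using E binop_graph_op(3)[OF B(1)] unfolding op by metis
    show "{pair (pair a b) (a \<otimes>\<^bsub>ring_of e E\<^esub> b) |a b. a \<in> carrier (ring_of e E) \<and> b \<in> carrier (ring_of e E)} \<in> sets"
      using E binop_graph_op(3)[OF B(2)] unfolding op by metis
    show "a = \<zero>\<^bsub>ring_of e E\<^esub> \<or> b = \<zero>\<^bsub>ring_of e E\<^esub>"
      if "a \<in> carrier (ring_of e E)" "b \<in> carrier (ring_of e E)" "a \<otimes>\<^bsub>ring_of e E\<^esub> b = \<zero>\<^bsub>ring_of e E\<^esub>" for a b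
      using that pid iff(2)[of a b "e 0"] unfolding op by metis
  next
    fix I assume I: "I \<in> sets" "I \<subseteq> carrier (ring_of e E)" "I \<noteq> {}"
      and closed: "\<And>a b r s. a \<in> I \<Longrightarrow> b \<in> I \<Longrightarrow> r \<in> carrier (ring_of e E) \<Longrightarrow> s \<in> carrier (ring_of e E) \<Longrightarrow>
        a \<otimes>\<^bsub>ring_of e E\<^esub> r \<oplus>\<^bsub>ring_of e E\<^esub> b \<otimes>\<^bsub>ring_of e E\<^esub> s \<in> I"
    obtain i where i: "i \<in> I" using I(3) by blast
    have "i \<otimes>\<^bsub>ring_of e E\<^esub> \<zero>\<^bsub>ring_of e E\<^esub> \<oplus>\<^bsub>ring_of e E\<^esub> i \<otimes>\<^bsub>ring_of e E\<^esub> \<zero>\<^bsub>ring_of e E\<^esub> \<in> I"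
      by (rule closed) (use i in simp_all)
    then have z: "e 0 \<in> I" using i I(2) by (simp add: subsetD) (simp add: op)
    \<comment> \<open>The sequence that enumerates \<open>I\<close>: n goes to itself if it lies in
      \<open>I\<close>, and otherwise to the default zero, which lies in \<open>I\<close> by the
      previous step.\<close>
    define F where "F = {w. \<exists>n x. w = pair n x \<and> (n \<in> I \<and> x = n \<or> n \<notin> I \<and> x = e 0)}"
    have F: "pair n x \<in> F \<longleftrightarrow> (n \<in> I \<and> x = n \<or> n \<notin> I \<and> x = e 0)" for n x
      unfolding F_def by auto
    have FI: "(\<exists>k. pair k x \<in> F) \<longleftrightarrow> x \<in> I" for x
      unfolding F using z by blast
    have "F \<in> sets" unfolding F_def
      by (rule comprehension) (intro definability I(1))
    moreover have "sat e (E(3 := F)) is_sigma1_ideal"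
    proof -
      have IC: "x \<in> I \<Longrightarrow> x \<in> E 0" for x using I(2) op by auto
      have "sat e (E(3 := F)) is_sigma1_ideal \<longleftrightarrow>
        (\<forall>w. w \<in> F \<longrightarrow> (\<exists>x y. y \<in> E 0 \<and> w = pair x y)) \<and>
        (\<forall>x. \<exists>y. y \<in> E 0 \<and> pair x y \<in> F) \<and>
        (\<forall>x y y'. pair x y \<in> F \<and> pair x y' \<in> F \<longrightarrow> y = y') \<and>
        (\<forall>i j r s ai aj u v w. r \<in> E 0 \<and> s \<in> E 0 \<and> pair i ai \<in> F \<and> pair j aj \<in> F \<and>
          pair (pair ai r) u \<in> E 2 \<and> pair (pair aj s) v \<in> E 2 \<and> pair (pair u v) w \<in> E 1 \<longrightarrow> (\<exists>k. pair k w \<in> F))"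
        by (simp add: is_sigma1_ideal_def is_fun_def Let_def)
      moreover have "\<exists>x y. y \<in> E 0 \<and> w = pair x y" if "w \<in> F" for w
        using that z IC unfolding F_def by blast
      moreover have "\<exists>y. y \<in> E 0 \<and> pair x y \<in> F" for x
        unfolding F using z IC by blast
      moreover have "y = y'" if "pair x y \<in> F" "pair x y' \<in> F" for x y y'
        using that unfolding F by blast
      moreover have "\<exists>k. pair k w \<in> F" if "r \<in> E 0" "s \<in> E 0" "pair i ai \<in> F" "pair j aj \<in> F"
        "pair (pair ai r) u \<in> E 2" "pair (pair aj s) v \<in> E 2" "pair (pair u v) w \<in> E 1" for i j r s ai aj u v w
      proof -
        have "ai \<in> I" "aj \<in> I" using that(3,4) FI by blast+
        then show ?thesis
          using closed[of ai aj r s] that unfolding FI op iff by simp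
      qed
      ultimately show ?thesis by blast
    qed
    ultimately obtain c where "c \<in> E 0" "\<forall>x. ((\<exists>k. pair k x \<in> F) \<longrightarrow> (\<exists>r. r \<in> E 0 \<and> pair (pair c r) x \<in> E 2)) \<and>
         ((\<forall>r. r \<in> E 0 \<longrightarrow> pair (pair c r) x \<notin> E 2) \<or> (\<exists>k. pair k x \<in> F))"
      using pid by (elim conjE bspec) auto
    then have "c \<in> E 0" "\<forall>x. (\<exists>k. pair k x \<in> F) \<longleftrightarrow> (\<exists>r. r \<in> E 0 \<and> pair (pair c r) x \<in> E 2)"
      by blast+
    then show "\<exists>c\<in>carrier (ring_of e E). \<forall>x. x \<in> I \<longleftrightarrow> (\<exists>r\<in>carrier (ring_of e E). x = c \<otimes>\<^bsub>ring_of e E\<^esub> r)"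
      unfolding FI iff op by blast
  qed
qed

lemma sat_Dedekind_Hasse:
  assumes sat: "sat e E is_sigma1_PID" and E: "\<forall>X. E X \<in> sets"
  shows "sat e E (ex_s [norm_var] is_Dedekind_Hasse_norm)"
proof -
  let ?R = "ring_of e E"
  interpret R: sigma1_PID "\<^bold>0" "\<^bold>1" "(\<uplus>)" "(\<odot>)" "(\<prec>)" sets ?R
    by (rule sat_is_sigma1_PID[OF assms])
  have op: "carrier ?R = E 0" "add ?R = graph_op (E 1)" "mult ?R = graph_op (E 2)" "zero ?R = e 0"
    by (simp_all add: ring_of_def)
  have "sat e E is_comm_ring"
    using sat by (simp add: is_sigma1_PID_def is_integral_domain_def Let_def)
  note iff = sat_is_comm_ring(1,2)[OF this, THEN binop_graph_op(2)]
  note closed = sat_is_comm_ring(1,2)[OF \<open>sat e E is_comm_ring\<close>, THEN binop_graph_op(1)]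
  define F where "F = {w. \<exists>b v. w = pair b v \<and> R.norm_is b v}"
  have F: "pair b v \<in> F \<longleftrightarrow> R.norm_is b v" for b v
    unfolding F_def by auto
  have carrier: "b \<in> E 0" if "R.norm_is b v" for b v
    using that unfolding R.norm_is_def op by blast
  have rdvd: "(\<exists>q. q \<in> E 0 \<and> pair (pair b q) a \<in> E 2) \<longleftrightarrow> R.rdvd b a" for a b
    unfolding R.rdvd_def iff op by blast
  \<comment> \<open>Arithmetical comprehension makes the norm a set of the model.\<close>
  have "F \<in> sets"
    unfolding F_def by (rule comprehension) (intro definability R.definable_norm_is)
  moreover have "sat e (E(norm_var := F)) is_Dedekind_Hasse_norm"
  proof -
    have "sat e (E(norm_var := F)) is_Dedekind_Hasse_norm \<longleftrightarrow>
      (\<forall>w. w \<in> F \<longrightarrow> (\<exists>x. x \<in> E 0 \<and> (\<exists>y. w = pair x y))) \<and>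
      (\<forall>x. x \<in> E 0 \<longrightarrow> (\<exists>y. pair x y \<in> F)) \<and>
      (\<forall>x y y'. pair x y \<in> F \<and> pair x y' \<in> F \<longrightarrow> y = y') \<and>
      (\<forall>a. a \<in> E 0 \<longrightarrow> (pair a \<^bold>0 \<in> F \<longrightarrow> a = e 0) \<and> (a = e 0 \<longrightarrow> pair (e 0) \<^bold>0 \<in> F)) \<and>
      (\<forall>a b. (a \<in> E 0 \<and> a \<noteq> e 0) \<and> b \<in> E 0 \<and> b \<noteq> e 0 \<longrightarrow> \<not> (\<exists>q. q \<in> E 0 \<and> pair (pair b q) a \<in> E 2) \<longrightarrow>
        (\<exists>x y u v w m n. x \<in> E 0 \<and> y \<in> E 0 \<and> pair (pair a x) u \<in> E 2 \<and> pair (pair b y) v \<in> E 2 \<and>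
          pair (pair u v) w \<in> E 1 \<and> pair w m \<in> F \<and> pair b n \<in> F \<and> \<^bold>0 \<prec> m \<and> m \<prec> n)) \<and>
      (\<forall>a b c m n. (a \<in> E 0 \<and> a \<noteq> e 0) \<and> (b \<in> E 0 \<and> b \<noteq> e 0) \<and> pair (pair a b) c \<in> E 2 \<and> pair a m \<in> F \<and> pair c n \<in> F \<longrightarrow>
        (\<not> m \<prec> n \<longrightarrow> m = n))"
      by (simp add: is_Dedekind_Hasse_norm_def is_fun_def Let_def)
    moreover have "\<exists>x. x \<in> E 0 \<and> (\<exists>y. w = pair x y)" if "w \<in> F" for w
      using that carrier unfolding F_def by blast
    moreover have "\<exists>y. pair x y \<in> F" if "x \<in> E 0" for x
      unfolding F using R.norm_is_exists that op by blast
    moreover have "y = y'" if "pair x y \<in> F" "pair x y' \<in> F" for x y y'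
      using that R.norm_is_unique unfolding F by blast
    moreover have "pair a \<^bold>0 \<in> F \<longleftrightarrow> a = e 0" if "a \<in> E 0" for a
      unfolding F using R.norm_is_zero that op by simp
    moreover have "\<exists>x y u v w m n. x \<in> E 0 \<and> y \<in> E 0 \<and> pair (pair a x) u \<in> E 2 \<and> pair (pair b y) v \<in> E 2 \<and>
          pair (pair u v) w \<in> E 1 \<and> pair w m \<in> F \<and> pair b n \<in> F \<and> \<^bold>0 \<prec> m \<and> m \<prec> n"
      if h: "a \<in> E 0" "b \<in> E 0" "b \<noteq> e 0" "\<not> (\<exists>q. q \<in> E 0 \<and> pair (pair b q) a \<in> E 2)" for a b
    proof -
      have "\<not> R.rdvd b a" using h(4) rdvd by blast
      then obtain x y m n where "x \<in> E 0" "y \<in> E 0"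
        "R.norm_is (graph_op (E 1) (graph_op (E 2) a x) (graph_op (E 2) b y)) m" "R.norm_is b n" "\<^bold>0 \<prec> m" "m \<prec> n"
        using R.norm_is_Dedekind_Hasse[of a b, unfolded op, OF h(1-3)] by auto
      moreover from this have "pair (pair a x) (graph_op (E 2) a x) \<in> E 2" "pair (pair b y) (graph_op (E 2) b y) \<in> E 2"
        "pair (pair (graph_op (E 2) a x) (graph_op (E 2) b y)) (graph_op (E 1) (graph_op (E 2) a x) (graph_op (E 2) b y)) \<in> E 1"
        using h(1,2) closed unfolding iff by simp_all
      ultimately show ?thesis unfolding F by blast
    qed
    moreover have "\<not> m \<prec> n \<longrightarrow> m = n"
      if "a \<in> E 0" "a \<noteq> e 0" "b \<in> E 0" "b \<noteq> e 0" "pair (pair a b) c \<in> E 2" "pair a m \<in> F" "pair c n \<in> F" for a b c m n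
    proof -
      have "R.rdvd a c" using that(3,5) rdvd by blast
      \<comment> \<open>\<open>norm_is_mono\<close> asks for a nonzero multiple, which the absence
        of zero divisors provides.\<close>
      moreover have "c \<noteq> e 0" using that R.integral[of a b] unfolding iff op by auto
      ultimately have "m \<preceq> n" using R.norm_is_mono[of a c m n] that(6,7) unfolding F op by blast
      then show ?thesis unfolding le_def by blast
    qed
    ultimately show ?thesis by blast
  qed
  ultimately show ?thesis by auto
qed

end

theorem theorem6p30:
  shows "ACA0 \<turnstile> sigma1_PIDs_have_Dedekind_Hasse_norm"
proof (rule ccontr)
  assume unprov: "\<not> (ACA0 \<turnstile> sigma1_PIDs_have_Dedekind_Hasse_norm)"
  have "basic_axioms \<subseteq> ACA0" by (auto simp: ACA0_def)
  from completeness[OF this unprov] obtain zr on pl ti ls and sets :: "nat set set" and e E where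
    M: "so_structure.models zr on pl ti ls sets ACA0" "\<forall>X. E X \<in> sets"
      "\<not> so_structure.sat zr on pl ti ls sets e E sigma1_PIDs_have_Dedekind_Hasse_norm"
    by blast
  interpret aca_model zr on pl ti ls sets
    by unfold_locales (use M in auto)
  have "sat e E sigma1_PIDs_have_Dedekind_Hasse_norm \<longleftrightarrow>
    (\<forall>A\<in>sets. \<forall>B\<in>sets. \<forall>C\<in>sets. \<forall>a b. sat (e(0 := a, 1 := b)) (E(0 := A, 1 := B, 2 := C)) is_sigma1_PID \<longrightarrow>
      sat (e(0 := a, 1 := b)) (E(0 := A, 1 := B, 2 := C)) (ex_s [norm_var] is_Dedekind_Hasse_norm))"
    by (simp add: sigma1_PIDs_have_Dedekind_Hasse_norm_def del: sat_ex_s)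
  also have "\<dots>"
    using M(2) by (intro ballI allI impI sat_Dedekind_Hasse) simp_all
  finally show False using M(3) by blast
qed

end
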